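(* The only $1$-block of $G=GL(V)$ is $\mathrm{Irr}(G)$, and the only unipotent $1$-block of $G$ is $\mathrm{Unip}(G)$. In particular, the unipotent $1$-blocks of $G$ satisfy an analogue of the Nakayama Conjecture: two unipotent characters $\chi_\lambda,\chi_\mu$ ($\lambda,\mu\vdash n$) belong to the same unipotent $1$-block of $G$ if and only if $\lambda$ and $\mu$ have the same $1$-core.
   Context: $n$ is a positive integer, $q$ a power of a prime, $V$ an $n$-dimensional vector space over $\mathbf F_q$, $G=GL(V)$, and $\mathrm{Irr}(G)$ is the set of irreducible complex characters of $G$. For a positive integer $d$, an element of $G$ is $d$-regular if its minimal polynomial has no irreducible factor of degree divisible by $d$, except possibly $X-1$. For $d=1$, the $1$-regular elements are exactly the unipotent elements of $G$. Let $\mathcal Y_d(1)$ be the set of $d$-regular elements. Two characters $\chi,\psi\in\mathrm{Irr}(G)$ are directly linked across $d$-regular elements if $\frac1{|G|}\sum_{y\in\mathcal Y_d(1)}\chi(y)\overline{\psi(y)}\ne0$. The $d$-blocks of $G$ are the equivalence classes of the transitive closure of direct linking on $\mathrm{Irr}(G)$. $\mathrm{Unip}(G)=\{\chi_\lambda:\lambda\vdash n\}$ is the set of unipotent characters, i.e. irreducible constituents of the permutation character of $G$ on the cosets of a Borel subgroup. They are labeled by partitions of $n$ in the standard way: for every composition $\nu$ of $n$, the multiplicity of $\chi_\lambda$ in the permutation character on the cosets of the standard parabolic $P_\nu$ equals the multiplicity of the irreducible character $\varphi_\lambda$ of $S_n$ in the permutation character on the cosets of the Young subgroup $S_\nu$.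 The unipotent $d$-blocks of $G$ are the equivalence classes of the transitive closure, on $\mathrm{Unip}(G)$, of direct linking across $d$-regular elements. The $d$-core of a partition is the partition obtained by removing $d$-hooks (rim hooks of length $d$) until none is left; the only $1$-core is the empty partition. *)

theory Defs
  imports
    "HOL-Algebra.Sym_Groups"
    "HOL-Algebra.Left_Coset"
    "HOL-Combinatorics.Permutations"
    "HOL-Computational_Algebra.Polynomial"
    "HOL-Library.FuncSet"
    "HOL-Library.Cardinality"
    "HOL-Number_Theory.Prime_Powers"
    "Jordan_Normal_Form.VS_Connect"
begin

section \<open>Complex characters of a finite group\<close>

definition representation :: "('g, 'b) monoid_scheme \<Rightarrow> nat \<Rightarrow> ('g \<Rightarrow> complex mat) \<Rightarrow> bool" where
  "representation G m \<rho> \<longleftrightarrow> \<rho> \<in> hom G (units_of (ring_mat TYPE(complex) m ()))"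

definition irreducible_representation ::
    "('g, 'b) monoid_scheme \<Rightarrow> nat \<Rightarrow> ('g \<Rightarrow> complex mat) \<Rightarrow> bool" where
  "irreducible_representation G m \<rho> \<longleftrightarrow> representation G m \<rho> \<and> m > 0 \<and>
     (\<forall>W. VectorSpace.subspace class_ring W (module_vec TYPE(complex) m) \<and>
          (\<forall>g\<in>carrier G. \<forall>w\<in>W. \<rho> g *\<^sub>v w \<in> W) \<longrightarrow>
          W = {0\<^sub>v m} \<or> W = carrier_vec m)"

text \<open>Characters are extensional functions on the carrier, so that equality of characters is
  equality of HOL functions.\<close>

definition character_of :: "('g, 'b) monoid_scheme \<Rightarrow> nat \<Rightarrow> ('g \<Rightarrow> complex mat) \<Rightarrow> 'g \<Rightarrow> complex" where
  "character_of G m \<rho> = (\<lambda>g\<in>carrier G. \<Sum>i<m. \<rho> g $$ (i, i))"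

definition Irr :: "('g, 'b) monoid_scheme \<Rightarrow> ('g \<Rightarrow> complex) set" where
  "Irr G = {character_of G m \<rho> | m \<rho>. irreducible_representation G m \<rho>}"

text \<open>The normalisation is by the order of the whole group, also when the sum runs over a proper
  subset \<open>Y\<close>.\<close>

definition inner_on ::
    "('g, 'b) monoid_scheme \<Rightarrow> 'g set \<Rightarrow> ('g \<Rightarrow> complex) \<Rightarrow> ('g \<Rightarrow> complex) \<Rightarrow> complex" where
  "inner_on G Y \<chi> \<psi> = (\<Sum>y\<in>Y. \<chi> y * cnj (\<psi> y)) / of_nat (Coset.order G)"

text \<open>The multiplicity of an irreducible character \<open>\<chi>\<close> in a character \<open>\<theta>\<close>.\<close>

definition multiplicity_in ::
    "('g, 'b) monoid_scheme \<Rightarrow> ('g \<Rightarrow> complex) \<Rightarrow> ('g \<Rightarrow> complex) \<Rightarrow> complex" where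
  "multiplicity_in G \<chi> \<theta> = inner_on G (carrier G) \<theta> \<chi>"

definition permutation_character ::
    "('g, 'b) monoid_scheme \<Rightarrow> 'g set \<Rightarrow> 'g \<Rightarrow> complex" where
  "permutation_character G H =
     (\<lambda>g\<in>carrier G. of_nat (card {C \<in> lcosets\<^bsub>G\<^esub> H. g <#\<^bsub>G\<^esub> C = C}))"

definition induced_character ::
    "('g, 'b) monoid_scheme \<Rightarrow> 'g set \<Rightarrow> ('g \<Rightarrow> complex) \<Rightarrow> 'g \<Rightarrow> complex" where
  "induced_character G H \<theta> =
     (\<lambda>g\<in>carrier G.
        (\<Sum>x \<in> {x \<in> carrier G. inv\<^bsub>G\<^esub> x \<otimes>\<^bsub>G\<^esub> g \<otimes>\<^bsub>G\<^esub> x \<in> H}.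
           \<theta> (inv\<^bsub>G\<^esub> x \<otimes>\<^bsub>G\<^esub> g \<otimes>\<^bsub>G\<^esub> x)) / of_nat (card H))"

definition direct_link ::
    "('g, 'b) monoid_scheme \<Rightarrow> 'g set \<Rightarrow> ('g \<Rightarrow> complex) set \<Rightarrow> (('g \<Rightarrow> complex) \<times> ('g \<Rightarrow> complex)) set" where
  "direct_link G Y S = {(\<chi>, \<psi>). \<chi> \<in> S \<and> \<psi> \<in> S \<and> inner_on G Y \<chi> \<psi> \<noteq> 0}"

text \<open>When \<open>\<one>\<^bsub>G\<^esub> \<in> Y\<close> and \<open>S \<subseteq> Irr G\<close>, direct linking is already reflexive on \<open>S\<close>, so the transitive
  closure is the right relation to take classes of.\<close>

definition linking_blocks ::
    "('g, 'b) monoid_scheme \<Rightarrow> 'g set \<Rightarrow> ('g \<Rightarrow> complex) set \<Rightarrow> ('g \<Rightarrow> complex) set set" where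
  "linking_blocks G Y S = S // (direct_link G Y S)\<^sup>+"


section \<open>Partitions and cores\<close>

definition composition_of :: "nat \<Rightarrow> nat list \<Rightarrow> bool" where
  "composition_of n \<nu> \<longleftrightarrow> 0 \<notin> set \<nu> \<and> sum_list \<nu> = n"

definition is_partition :: "nat list \<Rightarrow> bool" where
  "is_partition \<alpha> \<longleftrightarrow> 0 \<notin> set \<alpha> \<and> sorted_wrt (\<ge>) \<alpha>"

definition partitions :: "nat \<Rightarrow> nat list set" where
  "partitions n = {\<alpha>. is_partition \<alpha> \<and> sum_list \<alpha> = n}"

definition young_diagram :: "nat list \<Rightarrow> (nat \<times> nat) set" where
  "young_diagram \<alpha> = {(i, j). i < length \<alpha> \<and> j < \<alpha> ! i}"

definition conjugate_partition :: "nat list \<Rightarrow> nat list" where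
  "conjugate_partition \<alpha> =
     map (\<lambda>j. card {i. (i, j) \<in> young_diagram \<alpha>}) [0..<(if \<alpha> = [] then 0 else hd \<alpha>)]"

definition adjacent_cells :: "nat \<times> nat \<Rightarrow> nat \<times> nat \<Rightarrow> bool" where
  "adjacent_cells a b \<longleftrightarrow>
     (fst a = fst b \<and> (snd b = Suc (snd a) \<or> snd a = Suc (snd b))) \<or>
     (snd a = snd b \<and> (fst b = Suc (fst a) \<or> fst a = Suc (fst b)))"

definition connected_cells :: "(nat \<times> nat) set \<Rightarrow> bool" where
  "connected_cells R \<longleftrightarrow>
     (\<forall>a\<in>R. \<forall>b\<in>R. (a, b) \<in> {(x, y). x \<in> R \<and> y \<in> R \<and> adjacent_cells x y}\<^sup>*)"

text \<open>A rim hook is a connected skew diagram containing no two-by-two square.\<close>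

definition removes_rim_hook :: "nat \<Rightarrow> nat list \<Rightarrow> nat list \<Rightarrow> bool" where
  "removes_rim_hook d \<alpha> \<beta> \<longleftrightarrow>
     is_partition \<alpha> \<and> is_partition \<beta> \<and> young_diagram \<beta> \<subseteq> young_diagram \<alpha> \<and>
     (let R = young_diagram \<alpha> - young_diagram \<beta> in
        card R = d \<and> connected_cells R \<and>
        (\<nexists>i j. {(i, j), (Suc i, j), (i, Suc j), (Suc i, Suc j)} \<subseteq> R))"

definition d_core :: "nat \<Rightarrow> nat list \<Rightarrow> nat list" where
  "d_core d \<alpha> =
     (THE \<beta>. (\<alpha>, \<beta>) \<in> {(\<gamma>, \<delta>). removes_rim_hook d \<gamma> \<delta>}\<^sup>* \<and> (\<nexists>\<kappa>. removes_rim_hook d \<beta> \<kappa>))"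


section \<open>Irreducible characters of symmetric groups\<close>

definition young_subgroup :: "nat \<Rightarrow> nat list \<Rightarrow> (nat \<Rightarrow> nat) set" where
  "young_subgroup n \<nu> =
     {p \<in> carrier (sym_group n). \<forall>k < length \<nu>.
        p ` {sum_list (take k \<nu>) <.. sum_list (take (Suc k) \<nu>)} =
        {sum_list (take k \<nu>) <.. sum_list (take (Suc k) \<nu>)}}"

text \<open>The irreducible character of the symmetric group labelled by a partition \<open>\<alpha>\<close>: the unique common
  irreducible constituent of the trivial character induced from the Young subgroup of \<open>\<alpha>\<close> and the
  sign character induced from the Young subgroup of the conjugate of \<open>\<alpha>\<close> (James and Kerber). Thus
  \<open>(n)\<close> labels the trivial character.\<close>

definition sym_character :: "nat \<Rightarrow> nat list \<Rightarrow> (nat \<Rightarrow> nat) \<Rightarrow> complex" where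
  "sym_character n \<alpha> =
     (THE \<phi>. \<phi> \<in> Irr (sym_group n) \<and>
        multiplicity_in (sym_group n) \<phi>
          (permutation_character (sym_group n) (young_subgroup n \<alpha>)) \<noteq> 0 \<and>
        multiplicity_in (sym_group n) \<phi>
          (induced_character (sym_group n) (young_subgroup n (conjugate_partition \<alpha>))
             (\<lambda>p. of_int (sign p))) \<noteq> 0)"


section \<open>The general linear group of a vector space\<close>

text \<open>The vector space is the whole type \<open>'v\<close>, with scalar multiplication \<open>scale\<close>.\<close>

definition GL :: "('k::field \<Rightarrow> 'v::ab_group_add \<Rightarrow> 'v) \<Rightarrow> ('v \<Rightarrow> 'v) monoid" where
  "GL scale = \<lparr>carrier = {f. Vector_Spaces.linear scale scale f \<and> bij f}, mult = (\<circ>), one = id\<rparr>"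

definition poly_operator ::
    "('k::field \<Rightarrow> 'v::ab_group_add \<Rightarrow> 'v) \<Rightarrow> 'k poly \<Rightarrow> ('v \<Rightarrow> 'v) \<Rightarrow> 'v \<Rightarrow> 'v" where
  "poly_operator scale p f v = (\<Sum>i\<le>degree p. scale (coeff p i) ((f ^^ i) v))"

definition minimal_polynomial ::
    "('k::field \<Rightarrow> 'v::ab_group_add \<Rightarrow> 'v) \<Rightarrow> ('v \<Rightarrow> 'v) \<Rightarrow> 'k poly" where
  "minimal_polynomial scale f =
     (THE p. lead_coeff p = 1 \<and> (\<forall>v. poly_operator scale p f v = 0) \<and>
        (\<forall>r. (\<forall>v. poly_operator scale r f v = 0) \<longrightarrow> p dvd r))"

definition d_regular_elements ::
    "('k::field \<Rightarrow> 'v::ab_group_add \<Rightarrow> 'v) \<Rightarrow> nat \<Rightarrow> ('v \<Rightarrow> 'v) set" where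
  "d_regular_elements scale d =
     {f \<in> carrier (GL scale).
        \<forall>r. Factorial_Ring.irreducible r \<and> lead_coeff r = 1 \<and> r dvd minimal_polynomial scale f \<and> d dvd degree r \<longrightarrow>
            r = [:-1, 1:]}"

definition ordered_basis :: "('k::field \<Rightarrow> 'v::ab_group_add \<Rightarrow> 'v) \<Rightarrow> 'v list \<Rightarrow> bool" where
  "ordered_basis scale bs \<longleftrightarrow>
     distinct bs \<and> \<not> Modules.module.dependent scale (set bs) \<and>
     Modules.module.span scale (set bs) = UNIV"

text \<open>The stabiliser of the standard flag of type \<open>\<nu>\<close>; with respect to the basis \<open>bs\<close> it consists of the
  invertible block upper triangular matrices with diagonal blocks of sizes \<open>\<nu>\<close>.\<close>

definition standard_parabolic ::
    "('k::field \<Rightarrow> 'v::ab_group_add \<Rightarrow> 'v) \<Rightarrow> 'v list \<Rightarrow> nat list \<Rightarrow> ('v \<Rightarrow> 'v) set" where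
  "standard_parabolic scale bs \<nu> =
     {g \<in> carrier (GL scale). \<forall>k \<le> length \<nu>.
        g ` Modules.module.span scale (set (take (sum_list (take k \<nu>)) bs)) =
        Modules.module.span scale (set (take (sum_list (take k \<nu>)) bs))}"

definition standard_borel ::
    "('k::field \<Rightarrow> 'v::ab_group_add \<Rightarrow> 'v) \<Rightarrow> 'v list \<Rightarrow> ('v \<Rightarrow> 'v) set" where
  "standard_borel scale bs = standard_parabolic scale bs (replicate (length bs) 1)"

definition Unip ::
    "('k::field \<Rightarrow> 'v::ab_group_add \<Rightarrow> 'v) \<Rightarrow> 'v list \<Rightarrow> (('v \<Rightarrow> 'v) \<Rightarrow> complex) set" where
  "Unip scale bs =
     {\<chi> \<in> Irr (GL scale).
        multiplicity_in (GL scale) \<chi>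
          (permutation_character (GL scale) (standard_borel scale bs)) \<noteq> 0}"

text \<open>\<open>X \<alpha>\<close> is the unipotent character labelled by \<open>\<alpha>\<close>. There is exactly one such labelling up to its
  values outside the partitions of \<open>n\<close>, and it is a bijection onto the unipotent characters.\<close>

definition unipotent_labelling ::
    "('k::field \<Rightarrow> 'v::ab_group_add \<Rightarrow> 'v) \<Rightarrow> 'v list \<Rightarrow> (nat list \<Rightarrow> ('v \<Rightarrow> 'v) \<Rightarrow> complex) \<Rightarrow> bool" where
  "unipotent_labelling scale bs X \<longleftrightarrow>
     (let n = length bs in
       \<forall>\<alpha> \<in> partitions n. X \<alpha> \<in> Unip scale bs \<and>
         (\<forall>\<nu>. composition_of n \<nu> \<longrightarrow>
            multiplicity_in (GL scale) (X \<alpha>)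
              (permutation_character (GL scale) (standard_parabolic scale bs \<nu>)) =
            multiplicity_in (sym_group n) (sym_character n \<alpha>)
              (permutation_character (sym_group n) (young_subgroup n \<nu>))))"

end

theory Submission
  imports Defs
begin

text \<open>Every irreducible character is directly linked to the Steinberg character \<open>St\<close>: since \<open>St\<close>
  vanishes at all nontrivial unipotent elements, the sum of \<open>\<chi> \<cdot> St\<close> over the unipotent elements
  has the single nonzero term \<open>\<chi>(1) St(1)\<close>. As \<open>St\<close> is itself unipotent, the same holds inside the
  unipotent characters, and the combinatorial claim follows because all \<open>1\<close>-cores are empty.

  \<open>St\<close> is realised on the functions on complete flags whose sum over every panel is zero. Such a
  function is determined by its values on the flags opposite to a fixed flag, and these values are
  arbitrary: alternating sums over apartments give the delta functions. Hence a Borel element has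
  as trace the number of opposite flags that it fixes, which is zero for a nontrivial unipotent
  element. The Borel invariants form a line, and the invariant inner product then gives
  irreducibility.\<close>

section \<open>Characters of finite groups\<close>

text \<open>Membership in \<open>Irr\<close> asks for explicit matrices, so everything is arranged
  around one basis. In the delta functions of the opposite flags, Borel elements act by permutation
  matrices; this yields both the trace and the multiplicity in the permutation character on the
  Borel cosets. Irreducibility has two halves: averaging over the Borel subgroup puts the invariant
  function \<phi> into every nonzero invariant subspace, and the translates of \<phi> span the space
  because inner products with them are point evaluations. That opposite flags determine a function
  with zero panel sums rests on Bruhat order: a flag is measured by the permutation of its jumps
  against the base flag, and at an ascent the other members of the panel are closer to being
  opposite. A unipotent element is first conjugated so that it acts trivially on the steps of the
  base flag; fixing an opposite flag would then make it triangular in both directions, hence the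
  identity.\<close>

lemma trace_comm:
  fixes A B :: "complex mat"
  assumes "A \<in> carrier_mat m m" "B \<in> carrier_mat m m"
  shows "(\<Sum>i<m. (A * B) $$ (i, i)) = (\<Sum>i<m. (B * A) $$ (i, i))"
proof -
  have "(\<Sum>i<m. (A * B) $$ (i, i)) = (\<Sum>i<m. \<Sum>k<m. A $$ (i, k) * B $$ (k, i))"
    using assms by (auto simp: scalar_prod_def lessThan_atLeast0 intro!: sum.cong)
  also have "\<dots> = (\<Sum>k<m. \<Sum>i<m. B $$ (k, i) * A $$ (i, k))"
    by (subst sum.swap) (simp add: mult.commute)
  also have "\<dots> = (\<Sum>i<m. (B * A) $$ (i, i))"
    using assms by (auto simp: scalar_prod_def lessThan_atLeast0 intro!: sum.cong)
  finally show ?thesis .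
qed

context group
begin

lemma representationD:
  assumes "representation G m \<rho>"
  shows "\<And>g. g \<in> carrier G \<Longrightarrow> \<rho> g \<in> carrier_mat m m"
    and "\<And>g h. g \<in> carrier G \<Longrightarrow> h \<in> carrier G \<Longrightarrow> \<rho> (g \<otimes> h) = \<rho> g * \<rho> h"
    and "\<rho> \<one> = 1\<^sub>m m"
proof -
  show c: "\<rho> g \<in> carrier_mat m m" if "g \<in> carrier G" for g
    using assms that by (auto simp: representation_def hom_def units_of_def Units_def ring_mat_simps)
  show mult: "\<rho> (g \<otimes> h) = \<rho> g * \<rho> h" if "g \<in> carrier G" "h \<in> carrier G" for g h
    using assms that by (auto simp: representation_def hom_def units_of_def ring_mat_simps)
  obtain Q where Q: "Q \<in> carrier_mat m m" "Q * \<rho> \<one> = 1\<^sub>m m"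
    using assms by (auto simp: representation_def hom_def units_of_def Units_def ring_mat_simps)
  \<comment> \<open>Homomorphisms are only multiplicative by definition; an invertible idempotent
    matrix is the identity.\<close>
  have idem: "\<rho> \<one> * \<rho> \<one> = \<rho> \<one>" using mult[of \<one> \<one>] by simp
  have "\<rho> \<one> = Q * \<rho> \<one> * \<rho> \<one>"
    unfolding Q(2) by (rule left_mult_one_mat[OF c[OF one_closed], symmetric])
  also have "\<dots> = Q * \<rho> \<one>"
    unfolding assoc_mult_mat[OF Q(1) c[OF one_closed] c[OF one_closed]] idem ..
  finally show "\<rho> \<one> = 1\<^sub>m m" unfolding Q(2) .
qed

lemma character_one_ne_zero: "\<chi> \<in> Irr G \<Longrightarrow> \<chi> \<one> \<noteq> 0"
  by (auto simp: Irr_def irreducible_representation_def character_of_def representationD)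

lemma character_conj:
  assumes "\<chi> \<in> Irr G" "x \<in> carrier G" "g \<in> carrier G"
  shows "\<chi> (x \<otimes> g \<otimes> inv x) = \<chi> g"
proof -
  obtain m \<rho> where \<chi>: "representation G m \<rho>" "\<chi> = character_of G m \<rho>"
    using assms by (auto simp: Irr_def irreducible_representation_def)
  note \<rho> = representationD[OF \<chi>(1)]
  have "\<chi> (x \<otimes> g \<otimes> inv x) = (\<Sum>i<m. (\<rho> (x \<otimes> g) * \<rho> (inv x)) $$ (i, i))"
    using assms \<chi>(2) \<rho> by (simp add: character_of_def)
  also have "\<dots> = (\<Sum>i<m. (\<rho> (inv x) * \<rho> (x \<otimes> g)) $$ (i, i))"
    using assms by (intro trace_comm \<rho>(1)) auto
  also have "\<rho> (inv x) * \<rho> (x \<otimes> g) = \<rho> g"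
    using assms \<rho>(2)[of "inv x" "x \<otimes> g"] by (simp add: m_assoc[symmetric])
  finally show ?thesis
    using assms \<chi> by (simp add: character_of_def)
qed

text \<open>Frobenius reciprocity by double counting of pairs of a group element and a fixed coset:
  the stabiliser of the coset of x is the conjugate of B by x, over which a character has the same
  sum as over B.\<close>

lemma multiplicity_permutation_character:
  assumes fin: "finite (carrier G)" and B: "subgroup B G" and \<chi>: "\<chi> \<in> Irr G"
  shows "multiplicity_in G \<chi> (permutation_character G B) =
    of_nat (card (lcosets B)) * (\<Sum>b\<in>B. cnj (\<chi> b)) / of_nat (Coset.order G)"
proof -
  have finL: "finite (lcosets B)" by (auto simp: LCOSETS_def fin)
  have coset: "(\<Sum>g\<in>{g \<in> carrier G. g <# C = C}. cnj (\<chi> g)) = (\<Sum>b\<in>B. cnj (\<chi> b))"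
    if C: "C \<in> lcosets B" for C
  proof -
    obtain x where x: "x \<in> carrier G" "C = x <# B" using C by (auto simp: LCOSETS_def)
    have iff: "g <# C = C \<longleftrightarrow> inv x \<otimes> g \<otimes> x \<in> B" if g: "g \<in> carrier G" for g
    proof -
      have "g <# C = (g \<otimes> x) <# B"
        using g x subgroup.subset[OF B] by (simp add: lcos_m_assoc)
      moreover have "(g \<otimes> x) <# B = x <# B \<longleftrightarrow> g \<otimes> x \<in> x <# B"
        using g x B by (metis l_repr_independence lcos_self m_closed)
      moreover have "g \<otimes> x \<in> x <# B \<longleftrightarrow> inv x \<otimes> (g \<otimes> x) \<in> B"
        using g x B
        by (metis group_axioms m_closed subgroup.lcos_module_imp subgroup.lcos_module_rev)
      ultimately show ?thesis using g x by (simp add: m_assoc)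
    qed
    have cancel: "x \<otimes> (inv x \<otimes> y) = y" "inv x \<otimes> (x \<otimes> y) = y" if "y \<in> carrier G" for y
      using x that by (simp_all add: m_assoc[symmetric])
    show ?thesis
      by (rule sum.reindex_bij_witness[of _ "\<lambda>b. x \<otimes> b \<otimes> inv x" "\<lambda>g. inv x \<otimes> g \<otimes> x"])
        (use x iff subgroup.mem_carrier[OF B] character_conj[OF \<chi>, of "inv x"] in
          \<open>auto simp: m_assoc cancel\<close>)
  qed
  have "(\<Sum>g\<in>carrier G. permutation_character G B g * cnj (\<chi> g)) =
      (\<Sum>g\<in>carrier G. \<Sum>C\<in>lcosets B. if g <# C = C then cnj (\<chi> g) else 0)"
    using finL by (intro sum.cong)
      (auto simp: permutation_character_def sum.If_cases Int_def)
  also have "\<dots> = (\<Sum>C\<in>lcosets B. \<Sum>g\<in>{g \<in> carrier G. g <# C = C}. cnj (\<chi> g))"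
    using fin by (subst sum.swap) (auto simp: sum.If_cases Int_def intro!: sum.cong)
  also have "\<dots> = of_nat (card (lcosets B)) * (\<Sum>b\<in>B. cnj (\<chi> b))"
    using coset by simp
  finally show ?thesis
    by (simp add: multiplicity_in_def inner_on_def)
qed

end

section \<open>Function spaces determined by a cell\<close>

text \<open>For \<open>GL\<close>, \<Omega> is the set of complete flags, \<open>base\<close> the
  flag of the Borel subgroup, X its opposite flags and H the Steinberg space. \<open>H_inj\<close>
  and \<open>H_delta\<close> together say that restriction to X identifies H with all functions on
  X; a single delta function is enough, since translates by the stabiliser of \<open>base\<close>
  give the others (\<open>ex_delta\<close>). Elements of H are total functions, so they are compared
  on \<Omega> only.\<close>

locale cell_action = group G for G :: "('g, 'b) monoid_scheme" (structure) +
  fixes act :: "'g \<Rightarrow> 'f \<Rightarrow> 'f" and \<Omega> X :: "'f set" and base :: 'f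
    and H :: "('f \<Rightarrow> complex) set"
  assumes fin: "finite (carrier G)"
    and act_closed: "g \<in> carrier G \<Longrightarrow> y \<in> \<Omega> \<Longrightarrow> act g y \<in> \<Omega>"
    and act_one: "y \<in> \<Omega> \<Longrightarrow> act \<one> y = y"
    and act_mult: "g \<in> carrier G \<Longrightarrow> h \<in> carrier G \<Longrightarrow> y \<in> \<Omega> \<Longrightarrow> act (g \<otimes> h) y = act g (act h y)"
    and base: "base \<in> \<Omega>"
    and transitive: "y \<in> \<Omega> \<Longrightarrow> \<exists>g\<in>carrier G. y = act g base"
    and cell: "X \<subseteq> \<Omega>" "finite X" "X \<noteq> {}"
    and cell_closed: "b \<in> carrier G \<Longrightarrow> act b base = base \<Longrightarrow> x \<in> X \<Longrightarrow> act b x \<in> X"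
    and cell_transitive:
      "x \<in> X \<Longrightarrow> y \<in> X \<Longrightarrow> \<exists>b\<in>carrier G. act b base = base \<and> y = act b x"
    and H_zero: "(\<lambda>_. 0) \<in> H"
    and H_add: "f \<in> H \<Longrightarrow> f' \<in> H \<Longrightarrow> (\<lambda>y. f y + f' y) \<in> H"
    and H_scale: "f \<in> H \<Longrightarrow> (\<lambda>y. c * f y) \<in> H"
    and H_act: "f \<in> H \<Longrightarrow> g \<in> carrier G \<Longrightarrow> (\<lambda>y. f (act g y)) \<in> H"
    and H_inj: "f \<in> H \<Longrightarrow> \<forall>x\<in>X. f x = 0 \<Longrightarrow> y \<in> \<Omega> \<Longrightarrow> f y = 0"
    and H_delta: "\<exists>x\<in>X. \<exists>f\<in>H. f x = 1 \<and> (\<forall>y\<in>X - {x}. f y = 0)"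
begin

definition stab :: "'g set" where
  "stab = {b \<in> carrier G. act b base = base}"

lemma act_inv [simp]: "g \<in> carrier G \<Longrightarrow> y \<in> \<Omega> \<Longrightarrow> act (inv g) (act g y) = y"
  "g \<in> carrier G \<Longrightarrow> y \<in> \<Omega> \<Longrightarrow> act g (act (inv g) y) = y"
  using act_mult[of "inv g" g y] act_mult[of g "inv g" y] act_one by auto

lemma stab_subgroup: "subgroup stab G"
proof
  show "stab \<subseteq> carrier G" "\<one> \<in> stab"
    using act_one base by (auto simp: stab_def)
  show "x \<otimes> y \<in> stab" if "x \<in> stab" "y \<in> stab" for x y
    using that act_mult base by (auto simp: stab_def)
  show "inv x \<in> stab" if "x \<in> stab" for x
    using that act_inv(1)[of x base] base by (auto simp: stab_def)
qed

lemma stab_closed: "b \<in> stab \<Longrightarrow> b \<in> carrier G" "b \<in> stab \<Longrightarrow> inv b \<in> stab"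
  using subgroup.mem_carrier[OF stab_subgroup] subgroup.m_inv_closed[OF stab_subgroup] by auto

lemma cell_stab: "b \<in> stab \<Longrightarrow> x \<in> X \<Longrightarrow> act b x \<in> X"
  using cell_closed by (auto simp: stab_def)

lemma finite_stab: "finite stab"
  using fin by (auto simp: stab_def)

lemma card_stab: "card stab > 0"
  using finite_stab subgroup.one_closed[OF stab_subgroup] card_gt_0_iff by blast

lemma H_sum: "finite S \<Longrightarrow> (\<And>s. s \<in> S \<Longrightarrow> f s \<in> H) \<Longrightarrow> (\<lambda>y. \<Sum>s\<in>S. f s y) \<in> H"
  by (induction S rule: finite_induct) (auto intro: H_zero H_add)

lemma H_sum_scale:
  "finite S \<Longrightarrow> (\<And>s. s \<in> S \<Longrightarrow> f s \<in> H) \<Longrightarrow> (\<lambda>y. \<Sum>s\<in>S. c s * f s y) \<in> H"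
  by (intro H_sum H_scale)

lemma H_eqI:
  assumes "f \<in> H" "h \<in> H" "\<And>x. x \<in> X \<Longrightarrow> f x = h x" "y \<in> \<Omega>"
  shows "f y = h y"
proof -
  have "(\<lambda>y. f y + (-1) * h y) \<in> H"
    by (intro H_add H_scale assms)
  from H_inj[OF this] show ?thesis
    using assms by auto
qed

lemma ex_delta:
  assumes "x \<in> X"
  shows "\<exists>f\<in>H. f x = 1 \<and> (\<forall>y\<in>X - {x}. f y = 0)"
proof -
  obtain x0 f where f: "x0 \<in> X" "f \<in> H" "f x0 = 1" "\<forall>y\<in>X - {x0}. f y = 0"
    using H_delta by blast
  obtain b where b: "b \<in> stab" "x0 = act b x"
    using cell_transitive[OF assms f(1)] by (auto simp: stab_def)
  have "f (act b y) = 0" if "y \<in> X - {x}" for y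
  proof -
    have "act b y \<noteq> x0"
      using that b assms cell act_inv(1)[of b] stab_closed by (metis Diff_iff in_mono singletonI)
    then show ?thesis
      using f(4) that b cell_stab by auto
  qed
  then show ?thesis
    using H_act[OF f(2) stab_closed(1)[OF b(1)]] f(3) b(2) by (intro bexI[of _ "\<lambda>y. f (act b y)"]) auto
qed

section \<open>Coordinates on the cell and the matrix representation\<close>

definition cells :: "'f list" where
  "cells = (SOME xs. set xs = X \<and> distinct xs)"

lemma cells: "set cells = X" "distinct cells"
  using someI_ex[OF finite_distinct_list[OF cell(2)]] by (auto simp: cells_def)

definition m :: nat where "m = length cells"

lemma m_card: "m = card X"
  using cells distinct_card unfolding m_def by metis

lemma m_pos: "m > 0"
  using cell m_card card_gt_0_iff by auto

abbreviation pt :: "nat \<Rightarrow> 'f" where "pt i \<equiv> cells ! i"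

lemma pt_in [simp]: "i < m \<Longrightarrow> pt i \<in> X" "i < m \<Longrightarrow> pt i \<in> \<Omega>"
  using cells cell nth_mem unfolding m_def by blast+

lemma pt_eq_iff [simp]: "i < m \<Longrightarrow> j < m \<Longrightarrow> pt i = pt j \<longleftrightarrow> i = j"
  using cells unfolding m_def by (simp add: nth_eq_iff_index_eq)

lemma pt_ex: "x \<in> X \<Longrightarrow> \<exists>i<m. x = pt i"
  using cells unfolding m_def by (metis in_set_conv_nth)

text \<open>By \<open>H_inj\<close> the choice is unique on \<Omega>, which includes the points
  outside the cell.\<close>

definition delta :: "'f \<Rightarrow> 'f \<Rightarrow> complex" where
  "delta x = (SOME f. f \<in> H \<and> f x = 1 \<and> (\<forall>y\<in>X - {x}. f y = 0))"

lemma delta: "x \<in> X \<Longrightarrow> delta x \<in> H" "x \<in> X \<Longrightarrow> y \<in> X \<Longrightarrow> delta x y = (if y = x then 1 else 0)"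
  using someI_ex[OF ex_delta[of x, unfolded Bex_def]] unfolding delta_def by auto

lemma expand:
  assumes "f \<in> H" "y \<in> \<Omega>"
  shows "f y = (\<Sum>j<m. f (pt j) * delta (pt j) y)"
proof (rule H_eqI[OF assms(1) _ _ assms(2)])
  show "(\<lambda>y. \<Sum>j<m. f (pt j) * delta (pt j) y) \<in> H"
    by (intro H_sum_scale) (auto simp: delta)
  fix x assume "x \<in> X"
  then obtain i where i: "i < m" "x = pt i"
    using pt_ex by blast
  have "(\<Sum>j<m. f (pt j) * delta (pt j) x) = (\<Sum>j<m. if j = i then f (pt j) else 0)"
    using i by (intro sum.cong) (auto simp: delta)
  also have "\<dots> = f x"
    using i by simp
  finally show "f x = (\<Sum>j<m. f (pt j) * delta (pt j) x)" ..
qed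

text \<open>Matrix of translation by \<open>inv g\<close> in the delta basis: column j lists the
  translate of \<open>delta (pt j)\<close> on the cell. The argument may leave the cell, so values
  of delta functions on all of \<Omega> enter.\<close>

definition rep :: "'g \<Rightarrow> complex mat" where
  "rep g = mat m m (\<lambda>(i, j). delta (pt j) (act (inv g) (pt i)))"

lemma rep_carrier [simp]: "rep g \<in> carrier_mat m m"
  by (simp add: rep_def)

lemma rep_dim [simp]: "dim_row (rep g) = m" "dim_col (rep g) = m"
  by (simp_all add: rep_def)

lemma rep_index [simp]: "i < m \<Longrightarrow> j < m \<Longrightarrow> rep g $$ (i, j) = delta (pt j) (act (inv g) (pt i))"
  by (simp add: rep_def)

lemma rep_mult:
  assumes g: "g \<in> carrier G" and h: "h \<in> carrier G"
  shows "rep (g \<otimes> h) = rep g * rep h"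
proof (rule eq_matI)
  fix i j assume "i < dim_row (rep g * rep h)" "j < dim_col (rep g * rep h)"
  then have ij: "i < m" "j < m" by auto
  have "rep (g \<otimes> h) $$ (i, j) = delta (pt j) (act (inv h) (act (inv g) (pt i)))"
    using ij g h by (simp add: inv_mult_group act_mult)
  \<comment> \<open>The translate of \<open>delta (pt j)\<close> by \<open>inv h\<close> lies in H,
    so it can be expanded at the point \<open>act (inv g) (pt i)\<close>.\<close>
  also have "\<dots> = (\<Sum>k<m. delta (pt j) (act (inv h) (pt k)) * delta (pt k) (act (inv g) (pt i)))"
    using expand[OF H_act[OF delta(1)], of "pt j" "inv h" "act (inv g) (pt i)"] ij g h act_closed
    by auto
  also have "\<dots> = (rep g * rep h) $$ (i, j)"
    using ij by (auto simp: scalar_prod_def lessThan_atLeast0 intro!: sum.cong)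
  finally show "rep (g \<otimes> h) $$ (i, j) = (rep g * rep h) $$ (i, j)" .
qed auto

lemma rep_one: "rep \<one> = 1\<^sub>m m"
  by (rule eq_matI) (auto simp: act_one delta)

lemma rep_hom: "representation G m rep"
proof -
  have "rep g \<in> Units (ring_mat TYPE(complex) m ())" if "g \<in> carrier G" for g
    using rep_mult[of g "inv g"] rep_mult[of "inv g" g] rep_one that
    by (auto simp: Units_def ring_mat_simps intro!: bexI[of _ "rep (inv g)"])
  then show ?thesis
    unfolding representation_def by (auto simp: hom_def units_of_def ring_mat_simps rep_mult)
qed

text \<open>Inverse of restriction to the cell: the element of H with the entries of w as its values
  there. It turns matrix action into translation (\<open>fn_rep\<close>).\<close>

definition fn :: "complex vec \<Rightarrow> 'f \<Rightarrow> complex" where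
  "fn w y = (\<Sum>j<m. w $ j * delta (pt j) y)"

lemma fn_H: "fn w \<in> H"
  unfolding fn_def by (intro H_sum_scale) (auto simp: delta)

lemma fn_pt [simp]: "i < m \<Longrightarrow> fn w (pt i) = w $ i"
proof -
  assume i: "i < m"
  have "fn w (pt i) = (\<Sum>j<m. if j = i then w $ j else 0)"
    unfolding fn_def using i by (intro sum.cong) (auto simp: delta)
  then show ?thesis using i by simp
qed

lemma fn_rep:
  assumes "w \<in> carrier_vec m" "g \<in> carrier G" "y \<in> \<Omega>"
  shows "fn (rep g *\<^sub>v w) y = fn w (act (inv g) y)"
proof (rule H_eqI[OF fn_H H_act[OF fn_H] _ assms(3)])
  fix x assume "x \<in> X"
  then obtain i where i: "i < m" "x = pt i"
    using pt_ex by blast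
  have "fn (rep g *\<^sub>v w) x = (rep g *\<^sub>v w) $ i"
    using i by simp
  also have "\<dots> = fn w (act (inv g) x)"
    using assms i by (auto simp: scalar_prod_def fn_def lessThan_atLeast0 mult.commute intro!: sum.cong)
  finally show "fn (rep g *\<^sub>v w) x = fn w (act (inv g) x)" .
qed (use assms in auto)

section \<open>Averaging over the stabiliser and the invariant function\<close>

lemma sum_translate:
  assumes "g \<in> carrier G"
  shows "(\<Sum>h\<in>carrier G. F (g \<otimes> h)) = (\<Sum>h\<in>carrier G. F h)"
  by (rule sum.reindex_bij_witness[of _ "\<lambda>h. inv g \<otimes> h" "\<lambda>h. g \<otimes> h"])
    (use assms in \<open>auto simp: m_assoc[symmetric]\<close>)

lemma sum_stab_translate:
  assumes "b \<in> stab"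
  shows "(\<Sum>h\<in>stab. F (h \<otimes> b)) = (\<Sum>h\<in>stab. F h)"
  by (rule sum.reindex_bij_witness[of _ "\<lambda>h. h \<otimes> inv b" "\<lambda>h. h \<otimes> b"])
    (use assms in \<open>auto simp: m_assoc stab_closed subgroup.m_closed[OF stab_subgroup]\<close>)

lemma sum_stab_inv: "(\<Sum>h\<in>stab. F (inv h)) = (\<Sum>h\<in>stab. F h)"
  by (rule sum.reindex_bij_witness[of _ "m_inv G" "m_inv G"]) (auto simp: stab_closed)

text \<open>Since the stabiliser is transitive on the cell, its invariants in \<^term>\<open>H\<close> form a line.\<close>

lemma stab_average:
  assumes "f \<in> H"
  obtains c where "\<And>y. y \<in> \<Omega> \<Longrightarrow> (\<Sum>b\<in>stab. f (act b y)) = c * fn (vec m (\<lambda>_. 1)) y"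
proof -
  let ?s = "\<lambda>y. \<Sum>b\<in>stab. f (act b y)"
  have s: "?s \<in> H"
    by (intro H_sum H_act assms) (auto simp: finite_stab stab_closed)
  have const: "?s x = ?s (pt 0)" if x: "x \<in> X" for x
  proof -
    obtain b where b: "b \<in> stab" "x = act b (pt 0)"
      using cell_transitive[of "pt 0" x] x m_pos by (auto simp: stab_def)
    have "?s x = (\<Sum>h\<in>stab. f (act (h \<otimes> b) (pt 0)))"
      using b m_pos by (intro sum.cong) (auto simp: act_mult stab_closed)
    then show ?thesis
      using sum_stab_translate[OF b(1), of "\<lambda>h. f (act h (pt 0))"] by simp
  qed
  have "?s y = ?s (pt 0) * fn (vec m (\<lambda>_. 1)) y" if "y \<in> \<Omega>" for y
  proof (rule H_eqI[OF s H_scale[OF fn_H] _ that])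
    fix x assume x: "x \<in> X"
    then have "fn (vec m (\<lambda>_. 1)) x = 1"
      using pt_ex by fastforce
    then show "?s x = ?s (pt 0) * fn (vec m (\<lambda>_. 1)) x"
      using const[OF x] by (simp only: mult_1_right)
  qed
  then show thesis ..
qed

text \<open>Linear combinations are written entrywise, to be compared with sums of values of
  \<open>fn\<close> at the points of the cell.\<close>

lemma sum_in_subspace:
  assumes W: "VectorSpace.subspace class_ring W (module_vec TYPE(complex) m)"
    and "finite S" "\<And>s. s \<in> S \<Longrightarrow> v s \<in> W"
  shows "vec m (\<lambda>i. \<Sum>s\<in>S. c s * v s $ i) \<in> W"
  using assms(2,3)
proof (induction S rule: finite_induct)
  case empty
  have "vec m (\<lambda>i. 0) = (0\<^sub>v m :: complex vec)" by (intro eq_vecI) auto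
  then show ?case
    using W by (auto simp: VectorSpace.subspace_def LinearCombinations.submodule_def module_vec_simps)
next
  case (insert s S)
  have *: "v s \<in> carrier_vec m" "c s \<cdot>\<^sub>v v s \<in> W"
    using W insert.prems
    by (auto simp: VectorSpace.subspace_def LinearCombinations.submodule_def module_vec_simps class_ring_simps)
  then have "c s \<cdot>\<^sub>v v s + vec m (\<lambda>i. \<Sum>s\<in>S. c s * v s $ i) \<in> W"
    using W insert
    by (auto simp: VectorSpace.subspace_def LinearCombinations.submodule_def module_vec_simps class_ring_simps)
  also have "c s \<cdot>\<^sub>v v s + vec m (\<lambda>i. \<Sum>s\<in>S. c s * v s $ i) = vec m (\<lambda>i. \<Sum>s\<in>insert s S. c s * v s $ i)"
    using insert * by (intro eq_vecI) auto
  finally show ?case .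
qed

text \<open>Translate some function of the subspace so that it does not vanish at \<^term>\<open>base\<close>, then
  average over the stabiliser.\<close>

lemma ones_in_invariant:
  assumes W: "VectorSpace.subspace class_ring W (module_vec TYPE(complex) m)"
    and inv: "\<And>g w. g \<in> carrier G \<Longrightarrow> w \<in> W \<Longrightarrow> rep g *\<^sub>v w \<in> W"
    and w: "w \<in> W" "w \<noteq> 0\<^sub>v m"
  shows "vec m (\<lambda>_. 1) \<in> W" "fn (vec m (\<lambda>_. 1)) base \<noteq> 0"
proof -
  have WC: "W \<subseteq> carrier_vec m"
    using W by (auto simp: VectorSpace.subspace_def LinearCombinations.submodule_def module_vec_simps)
  obtain i where i: "i < m" "w $ i \<noteq> 0"
    using w WC by (metis carrier_vecD eq_vecI index_zero_vec subsetD)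
  obtain g where g: "g \<in> carrier G" "pt i = act g base"
    using transitive i pt_in by blast
  define v where "v = rep (inv g) *\<^sub>v w"
  have v: "v \<in> W" "v \<in> carrier_vec m"
    using inv g w WC unfolding v_def by auto
  have "fn v base = w $ i"
    using fn_rep[of w "inv g" base] fn_pt[OF i(1), of w] g w WC base unfolding v_def by auto
  with i have v0: "fn v base \<noteq> 0" by simp
  obtain c where c: "\<And>y. y \<in> \<Omega> \<Longrightarrow> (\<Sum>b\<in>stab. fn v (act b y)) = c * fn (vec m (\<lambda>_. 1)) y"
    using stab_average[OF fn_H] by blast
  \<comment> \<open>The stabiliser fixes \<open>base\<close>, so all terms agree there and the sum
    is nonzero; hence both factors in the description of the average are nonzero.\<close>
  have "(\<Sum>b\<in>stab. fn v (act b base)) = of_nat (card stab) * fn v base"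
    by (simp add: stab_def)
  then have c0: "c \<noteq> 0" "fn (vec m (\<lambda>_. 1)) base \<noteq> 0"
    using c[OF base] v0 card_stab by auto
  have "vec m (\<lambda>i. \<Sum>b\<in>stab. (1 / c) * (rep b *\<^sub>v v) $ i) \<in> W"
    using v inv stab_closed by (intro sum_in_subspace[OF W finite_stab]) auto
  also have "vec m (\<lambda>i. \<Sum>b\<in>stab. (1 / c) * (rep b *\<^sub>v v) $ i) = vec m (\<lambda>_. 1)"
  proof (rule eq_vecI)
    fix i assume "i < dim_vec (vec m (\<lambda>_. 1 :: complex))"
    then have i: "i < m" by simp
    have "(\<Sum>b\<in>stab. (rep b *\<^sub>v v) $ i) = (\<Sum>b\<in>stab. fn (rep b *\<^sub>v v) (pt i))"
      using i by simp
    also have "\<dots> = (\<Sum>b\<in>stab. fn v (act (inv b) (pt i)))"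
      using i v by (intro sum.cong refl fn_rep) (auto simp: stab_closed)
    \<comment> \<open>The representation translates by \<open>inv b\<close>; summation over a
      subgroup absorbs the inverse.\<close>
    also have "\<dots> = c"
      using sum_stab_inv[of "\<lambda>b. fn v (act b (pt i))"] c[of "pt i"] i by simp
    finally show "vec m (\<lambda>i. \<Sum>b\<in>stab. (1 / c) * (rep b *\<^sub>v v) $ i) $ i = vec m (\<lambda>_. 1) $ i"
      using i c0 by (simp add: sum_distrib_left[symmetric] sum_divide_distrib[symmetric])
  qed simp
  finally show "vec m (\<lambda>_. 1) \<in> W" "fn (vec m (\<lambda>_. 1)) base \<noteq> 0"
    using c0 by auto
qed

text \<open>The second conclusion of \<open>ones_in_invariant\<close> does not mention W, so it can
  be read off from the whole space.\<close>

lemma base_value_ne_zero: "fn (vec m (\<lambda>_. 1)) base \<noteq> 0"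
proof -
  interpret V: vec_space "TYPE(complex)" m .
  have "VectorSpace.subspace class_ring (carrier_vec m) (module_vec TYPE(complex) m)"
    using V.vectorspace_axioms V.module_axioms
    by (auto simp: VectorSpace.subspace_def LinearCombinations.submodule_def module_vec_simps)
  moreover have "rep g *\<^sub>v w \<in> carrier_vec m" if "w \<in> carrier_vec m" for g w
    by (metis mult_mat_vec_carrier rep_carrier that)
  moreover have "vec m (\<lambda>_. 1 :: complex) \<noteq> 0\<^sub>v m"
    using m_pos by (metis index_vec index_zero_vec(1) zero_neq_one)
  ultimately show ?thesis
    using ones_in_invariant[of "carrier_vec m" "vec m (\<lambda>_. 1)"] by auto
qed

text \<open>The spherical function of the representation: the stabiliser-invariant element of H,
  normalised at \<open>base\<close>.\<close>

definition \<phi> :: "'f \<Rightarrow> complex" where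
  "\<phi> y = fn (vec m (\<lambda>_. 1)) y / fn (vec m (\<lambda>_. 1)) base"

lemma \<phi>_H: "\<phi> \<in> H"
  using H_scale[OF fn_H, of "1 / fn (vec m (\<lambda>_. 1)) base" "vec m (\<lambda>_. 1)"]
  by (simp add: \<phi>_def[abs_def])

lemma \<phi>_base [simp]: "\<phi> base = 1"
  using base_value_ne_zero by (simp add: \<phi>_def)

lemma stab_average_\<phi>:
  assumes "f \<in> H" "y \<in> \<Omega>"
  shows "(\<Sum>b\<in>stab. f (act b y)) = of_nat (card stab) * f base * \<phi> y"
proof -
  obtain c where c: "\<And>y. y \<in> \<Omega> \<Longrightarrow> (\<Sum>b\<in>stab. f (act b y)) = c * fn (vec m (\<lambda>_. 1)) y"
    using stab_average[OF assms(1)] by blast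
  have "(\<Sum>b\<in>stab. f (act b base)) = of_nat (card stab) * f base"
    by (simp add: stab_def)
  then show ?thesis
    using c[OF base] c[OF assms(2)] base_value_ne_zero by (simp add: \<phi>_def field_simps)
qed

text \<open>Averages over the stabiliser are invariant, and by \<open>stab_average_\<phi>\<close>
  the sum of the translates of \<phi> is a nonzero multiple of \<phi>.\<close>

lemma \<phi>_stab:
  assumes "b \<in> stab" "y \<in> \<Omega>"
  shows "\<phi> (act b y) = \<phi> y"
proof -
  have y': "act b y \<in> \<Omega>" using assms act_closed stab_closed by auto
  have "(\<Sum>h\<in>stab. \<phi> (act h (act b y))) = (\<Sum>h\<in>stab. \<phi> (act (h \<otimes> b) y))"
    using assms by (intro sum.cong) (auto simp: act_mult stab_closed)
  also have "\<dots> = (\<Sum>h\<in>stab. \<phi> (act h y))"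
    by (rule sum_stab_translate[OF assms(1), of "\<lambda>h. \<phi> (act h y)"])
  finally show ?thesis
    using stab_average_\<phi>[OF \<phi>_H y'] stab_average_\<phi>[OF \<phi>_H assms(2)] card_stab by simp
qed

text \<open>Squared norm of \<phi>. The inner product sums over the group in place of \<Omega>,
  counting each point \<open>card stab\<close> times, so that its invariance is a translation of the
  summation variable.\<close>

definition \<kappa> :: complex where "\<kappa> = (\<Sum>g\<in>carrier G. \<phi> (act g base) * cnj (\<phi> (act g base)))"

lemma \<kappa>_real: "cnj \<kappa> = \<kappa>"
  unfolding \<kappa>_def by (simp add: mult.commute)

lemma \<kappa>_ne_zero: "\<kappa> \<noteq> 0"
proof -
  let ?r = "\<Sum>g\<in>carrier G. (cmod (\<phi> (act g base)))\<^sup>2"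
  have "\<kappa> = of_real ?r"
    unfolding \<kappa>_def of_real_sum by (intro sum.cong refl) (metis complex_norm_square)
  moreover have "?r > 0"
    by (rule sum_pos2[OF fin one_closed]) (use act_one[OF base] in auto)
  ultimately show ?thesis by (metis of_real_eq_0_iff less_irrefl)
qed

text \<open>As \<phi> is stabiliser-invariant, f may be replaced by its average over the stabiliser,
  and this average is \<open>f base\<close> times \<phi>.\<close>

lemma reproducing_base:
  assumes "f \<in> H"
  shows "(\<Sum>g\<in>carrier G. f (act g base) * cnj (\<phi> (act g base))) = \<kappa> * f base"
proof -
  let ?S = "\<Sum>g\<in>carrier G. f (act g base) * cnj (\<phi> (act g base))"
  have "of_nat (card stab) * ?S = (\<Sum>b\<in>stab. \<Sum>g\<in>carrier G. f (act (b \<otimes> g) base) * cnj (\<phi> (act (b \<otimes> g) base)))"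
    using sum_translate[of _ "\<lambda>g. f (act g base) * cnj (\<phi> (act g base))"] stab_closed by simp
  also have "\<dots> = (\<Sum>b\<in>stab. \<Sum>g\<in>carrier G. f (act b (act g base)) * cnj (\<phi> (act g base)))"
    by (intro sum.cong refl) (simp add: act_mult base stab_closed \<phi>_stab act_closed)
  also have "\<dots> = (\<Sum>g\<in>carrier G. (\<Sum>b\<in>stab. f (act b (act g base))) * cnj (\<phi> (act g base)))"
    by (subst sum.swap) (simp add: sum_distrib_right)
  also have "\<dots> = (\<Sum>g\<in>carrier G. of_nat (card stab) * f base * (\<phi> (act g base) * cnj (\<phi> (act g base))))"
    using stab_average_\<phi>[OF assms] act_closed base by (intro sum.cong) auto
  also have "\<dots> = of_nat (card stab) * (\<kappa> * f base)"
    by (simp add: \<kappa>_def sum_distrib_left[symmetric])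
  finally show ?thesis
    using card_stab by simp
qed

lemma reproducing:
  assumes "f \<in> H" "h \<in> carrier G"
  shows "(\<Sum>g\<in>carrier G. f (act g base) * cnj (\<phi> (act (inv h) (act g base)))) = \<kappa> * f (act h base)"
proof -
  have "\<kappa> * f (act h base) = (\<Sum>g\<in>carrier G. f (act h (act g base)) * cnj (\<phi> (act g base)))"
    using reproducing_base[OF H_act[OF assms]] by simp
  also have "\<dots> = (\<Sum>g\<in>carrier G. f (act (h \<otimes> g) base) * cnj (\<phi> (act (inv h) (act (h \<otimes> g) base))))"
    using assms base by (intro sum.cong refl) (simp add: act_mult act_closed)
  also have "\<dots> = (\<Sum>g\<in>carrier G. f (act g base) * cnj (\<phi> (act (inv h) (act g base))))"
    by (rule sum_translate[OF assms(2), of "\<lambda>g. f (act g base) * cnj (\<phi> (act (inv h) (act g base)))"])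
  finally show ?thesis ..
qed

text \<open>Both sides are, up to the real factor \<kappa>, the inner product of two translates of
  \<phi>, taken in the two possible orders.\<close>

lemma \<phi>_hermitian:
  assumes "g \<in> carrier G" "h \<in> carrier G"
  shows "\<phi> (act (inv g) (act h base)) = cnj (\<phi> (act (inv h) (act g base)))"
proof -
  have "\<kappa> * \<phi> (act (inv g) (act h base)) =
    cnj (\<Sum>k\<in>carrier G. \<phi> (act (inv h) (act k base)) * cnj (\<phi> (act (inv g) (act k base))))"
    using reproducing[OF H_act[OF \<phi>_H, of "inv g"], of h] assms
    by (simp add: mult.commute)
  also have "\<dots> = cnj (\<kappa> * \<phi> (act (inv h) (act g base)))"
    using reproducing[OF H_act[OF \<phi>_H, of "inv h"], of g] assms by simp
  finally show ?thesis
    using \<kappa>_ne_zero \<kappa>_real by simp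
qed

text \<open>By \<open>reproducing\<close> the translates of \<open>\<phi>\<close> represent the evaluations; the symmetry of this
  reproducing kernel turns the representation into an expansion in those translates.\<close>

lemma expand_\<phi>:
  assumes "f \<in> H" "y \<in> \<Omega>"
  shows "f y = (\<Sum>g\<in>carrier G. f (act g base) * \<phi> (act (inv g) y)) / \<kappa>"
proof -
  obtain h where h: "h \<in> carrier G" "y = act h base"
    using transitive assms by blast
  have "\<kappa> * f y = (\<Sum>g\<in>carrier G. f (act g base) * cnj (\<phi> (act (inv h) (act g base))))"
    using reproducing[OF assms(1) h(1)] h(2) by simp
  also have "\<dots> = (\<Sum>g\<in>carrier G. f (act g base) * \<phi> (act (inv g) y))"
    using \<phi>_hermitian h by (intro sum.cong refl) metis
  finally show ?thesis
    using \<kappa>_ne_zero by (metis nonzero_mult_div_cancel_left)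
qed

text \<open>A nonzero invariant subspace contains the all-ones vector, which represents a multiple
  of \<phi>; by \<open>expand_\<phi>\<close> the translates of \<phi> span H.\<close>

lemma rep_irreducible: "irreducible_representation G m rep"
  unfolding irreducible_representation_def
proof (intro conjI allI impI rep_hom m_pos)
  fix W
  assume "VectorSpace.subspace class_ring W (module_vec TYPE(complex) m) \<and>
    (\<forall>g\<in>carrier G. \<forall>w\<in>W. rep g *\<^sub>v w \<in> W)"
  then have W: "VectorSpace.subspace class_ring W (module_vec TYPE(complex) m)"
    and inv: "\<And>g w. g \<in> carrier G \<Longrightarrow> w \<in> W \<Longrightarrow> rep g *\<^sub>v w \<in> W" by auto
  have WC: "W \<subseteq> carrier_vec m" "0\<^sub>v m \<in> W"
    using W by (auto simp: VectorSpace.subspace_def LinearCombinations.submodule_def module_vec_simps)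
  show "W = {0\<^sub>v m} \<or> W = carrier_vec m"
  proof (cases "W = {0\<^sub>v m}")
    case False
    then obtain w where "w \<in> W" "w \<noteq> 0\<^sub>v m" using WC by blast
    then have ones: "vec m (\<lambda>_. 1) \<in> W"
      using ones_in_invariant[OF W inv] by blast
    have "v \<in> W" if v: "v \<in> carrier_vec m" for v
    proof -
      \<comment> \<open>The coefficients of \<open>expand_\<phi>\<close>, with a further division
        because \<phi> is the all-ones function divided by its value at \<open>base\<close>.\<close>
      define c where "c g = fn v (act g base) / (\<kappa> * fn (vec m (\<lambda>_. 1)) base)" for g
      have "vec m (\<lambda>i. \<Sum>g\<in>carrier G. c g * (rep g *\<^sub>v vec m (\<lambda>_. 1)) $ i) \<in> W"
        using ones inv by (intro sum_in_subspace[OF W fin]) auto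
      also have "vec m (\<lambda>i. \<Sum>g\<in>carrier G. c g * (rep g *\<^sub>v vec m (\<lambda>_. 1)) $ i) = v"
      proof (rule eq_vecI)
        fix i assume "i < dim_vec v"
        then have i: "i < m" using v by simp
        have "(\<Sum>g\<in>carrier G. c g * (rep g *\<^sub>v vec m (\<lambda>_. 1)) $ i) =
            (\<Sum>g\<in>carrier G. c g * fn (rep g *\<^sub>v vec m (\<lambda>_. 1)) (pt i))"
          using i by simp
        also have "\<dots> = (\<Sum>g\<in>carrier G. fn v (act g base) * \<phi> (act (inv g) (pt i)) / \<kappa>)"
          using i by (intro sum.cong refl, subst fn_rep) (auto simp: c_def \<phi>_def)
        also have "\<dots> = fn v (pt i)"
          using expand_\<phi>[OF fn_H, of "pt i" v] i by (simp add: sum_divide_distrib)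
        finally show "vec m (\<lambda>i. \<Sum>g\<in>carrier G. c g * (rep g *\<^sub>v vec m (\<lambda>_. 1)) $ i) $ i = v $ i"
          using i by simp
      qed (use v in simp)
      finally show ?thesis .
    qed
    then show ?thesis using WC by blast
  qed simp
qed

section \<open>The character of the representation\<close>

definition \<chi> :: "'g \<Rightarrow> complex" where "\<chi> = character_of G m rep"

lemma \<chi>_Irr: "\<chi> \<in> Irr G"
  unfolding \<chi>_def Irr_def mem_Collect_eq
  by (rule exI[of _ m], rule exI[of _ rep]) (simp add: rep_irreducible)

text \<open>The stabiliser permutes the cell, so its elements have permutation matrices in the delta
  basis.\<close>

lemma \<chi>_stab:
  assumes "b \<in> stab"
  shows "\<chi> b = of_nat (card {x \<in> X. act b x = x})"
proof -
  have iff: "act (inv b) x = x \<longleftrightarrow> act b x = x" if "x \<in> X" for x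
    using that cell act_inv[of b x] assms stab_closed by (metis subsetD)
  have "\<chi> b = (\<Sum>i<m. if act b (pt i) = pt i then 1 else 0)"
    using assms stab_closed cell_stab iff unfolding \<chi>_def character_of_def
    by (auto intro!: sum.cong simp: delta)
  also have "\<dots> = (\<Sum>x\<in>X. if act b x = x then 1 else 0)"
  proof -
    have "bij_betw pt {..<m} X"
      using cells unfolding m_def by (metis bij_betw_nth)
    then show ?thesis by (rule sum.reindex_bij_betw)
  qed
  also have "\<dots> = of_nat (card {x \<in> X. act b x = x})"
    using cell by (simp add: sum.If_cases Int_def)
  finally show ?thesis .
qed

text \<open>On the stabiliser the character counts fixed points, so its sum there is a natural
  number, to which the unit alone contributes the size of the cell.\<close>

lemma \<chi>_multiplicity:
  "multiplicity_in G \<chi> (permutation_character G stab) \<noteq> 0"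
proof -
  have "(\<Sum>b\<in>stab. card {x \<in> X. act b x = x}) > 0"
  proof (rule sum_pos2[OF finite_stab])
    show "\<one> \<in> stab" using subgroup.one_closed[OF stab_subgroup] .
    show "card {x \<in> X. act \<one> x = x} > 0"
      using cell act_one by (auto simp: card_gt_0_iff)
  qed auto
  moreover have "(\<Sum>b\<in>stab. cnj (\<chi> b)) = of_nat (\<Sum>b\<in>stab. card {x \<in> X. act b x = x})"
    by (simp add: \<chi>_stab)
  ultimately have "(\<Sum>b\<in>stab. cnj (\<chi> b)) \<noteq> 0"
    by (simp del: of_nat_sum)
  moreover have "card (lcosets stab) > 0"
    using fin by (auto simp: card_gt_0_iff LCOSETS_def)
  moreover have "Coset.order G > 0"
    using fin by (auto simp: Coset.order_def card_gt_0_iff)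
  ultimately show ?thesis
    using multiplicity_permutation_character[OF fin stab_subgroup \<chi>_Irr] by simp
qed

end

section \<open>The Steinberg representation on complete flags\<close>

locale flag_space = vector_space scale
  for scale :: "'k::{field,finite} \<Rightarrow> 'v::ab_group_add \<Rightarrow> 'v" +
  fixes bs :: "'v list"
  assumes basis: "ordered_basis scale bs"
begin

definition n :: nat where "n = length bs"

abbreviation G where "G \<equiv> GL scale"

text \<open>From index n on, \<open>take\<close> returns the whole basis and the value is the whole
  space; equality of flags is thus equality of functions on all indices.\<close>

definition flag :: "'v list \<Rightarrow> nat \<Rightarrow> 'v set" where
  "flag vs = (\<lambda>i. span (set (take i vs)))"

definition flags :: "(nat \<Rightarrow> 'v set) set" where
  "flags = flag ` {vs. ordered_basis scale vs}"

definition image_flag :: "('v \<Rightarrow> 'v) \<Rightarrow> (nat \<Rightarrow> 'v set) \<Rightarrow> nat \<Rightarrow> 'v set" where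
  "image_flag g F = (\<lambda>i. g ` F i)"

lemma basisD:
  assumes "ordered_basis scale vs"
  shows "distinct vs" "independent (set vs)" "span (set vs) = UNIV"
  using assms by (auto simp: ordered_basis_def)

lemma length_basis:
  assumes "ordered_basis scale vs"
  shows "length vs = dim (UNIV :: 'v set)"
  using dim_eq_card[of "set vs" UNIV] basisD[OF assms] by (simp add: distinct_card)

lemma length_n: "ordered_basis scale vs \<Longrightarrow> length vs = n"
  using length_basis length_basis[OF basis] by (simp add: n_def)

lemma finite_UNIV: "finite (UNIV :: 'v set)"
proof -
  have "UNIV \<subseteq> (\<lambda>u. \<Sum>v\<in>set bs. scale (u v) v) ` (set bs \<rightarrow>\<^sub>E UNIV)"
  proof
    fix x :: 'v
    have "x \<in> range (\<lambda>u. \<Sum>v\<in>set bs. scale (u v) v)"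
      using basisD(3)[OF basis] span_finite[of "set bs"] by simp
    then obtain u where "x = (\<Sum>v\<in>set bs. scale (u v) v)" by blast
    then have "x = (\<Sum>v\<in>set bs. scale (restrict u (set bs) v) v)" by simp
    then show "x \<in> (\<lambda>u. \<Sum>v\<in>set bs. scale (u v) v) ` (set bs \<rightarrow>\<^sub>E UNIV)"
      by (intro image_eqI[of _ _ "restrict u (set bs)"]) auto
  qed
  then show ?thesis
    by (rule finite_subset) (intro finite_imageI finite_PiE, auto)
qed

lemma GL_iff: "g \<in> carrier G \<longleftrightarrow> Vector_Spaces.linear scale scale g \<and> bij g"
  by (simp add: GL_def)

lemma group_GL: "group G"
proof (rule groupI)
  interpret vector_space_pair scale scale ..
  show "x \<otimes>\<^bsub>G\<^esub> y \<in> carrier G" if "x \<in> carrier G" "y \<in> carrier G" for x y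
    using that by (auto simp: GL_def intro: Vector_Spaces.linear_compose bij_comp)
  show "\<one>\<^bsub>G\<^esub> \<in> carrier G"
    using linear_id by (simp add: GL_def)
  show "\<exists>y\<in>carrier G. y \<otimes>\<^bsub>G\<^esub> x = \<one>\<^bsub>G\<^esub>" if "x \<in> carrier G" for x
  proof -
    have x: "Vector_Spaces.linear scale scale x" "inj x" "bij x"
      using that by (auto simp: GL_def bij_def)
    then obtain y where y: "Vector_Spaces.linear scale scale y" "y \<circ> x = id"
      using linear_injective_left_inverse by blast
    then have "y \<circ> x = id" "x \<circ> y = id"
      using x(3) by (metis bij_betw_def comp_assoc comp_id fun.map_comp id_comp inv_o_cancel surj_iff)+
    then have "bij y" using o_bij by blast
    with y show ?thesis by (auto simp: GL_def)
  qed
qed (auto simp: GL_def)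

interpretation G: group G by (rule group_GL)

lemma mult_GL [simp]: "g \<otimes>\<^bsub>G\<^esub> h = g \<circ> h" and one_GL [simp]: "\<one>\<^bsub>G\<^esub> = id"
  by (simp_all add: GL_def)



lemma finite_GL: "finite (carrier G)"
proof -
  have "finite (UNIV \<rightarrow>\<^sub>E UNIV :: ('v \<Rightarrow> 'v) set)"
    by (intro finite_PiE) (auto simp: finite_UNIV)
  then show ?thesis by (auto intro: finite_subset simp: PiE_UNIV_domain)
qed

lemma finite_flags: "finite flags"
proof -
  have "finite {vs. set vs \<subseteq> (UNIV :: 'v set) \<and> length vs = n}"
    using finite_lists_length_eq[OF finite_UNIV] .
  then have "finite {vs. ordered_basis scale vs}"
    by (rule rev_finite_subset) (auto simp: length_n)
  then show ?thesis by (simp add: flags_def)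
qed

lemma map_basis:
  assumes g: "g \<in> carrier G" and vs: "ordered_basis scale vs"
  shows "ordered_basis scale (map g vs)"
proof -
  interpret g: Vector_Spaces.linear scale scale g using g by (simp add: GL_iff)
  have "inj g" "range g = UNIV" using g by (auto simp: GL_iff bij_def)
  then show ?thesis
    using basisD[OF vs] g.span_image[of "set vs"] g.independent_injective_image[of "set vs"]
    by (auto simp: ordered_basis_def distinct_map intro: inj_on_subset)
qed

lemma image_flag_flag:
  assumes "g \<in> carrier G"
  shows "image_flag g (flag vs) = flag (map g vs)"
proof -
  interpret g: Vector_Spaces.linear scale scale g using assms by (simp add: GL_iff)
  show ?thesis
    by (auto simp: image_flag_def flag_def take_map g.span_image)
qed

lemma image_flag_closed: "g \<in> carrier G \<Longrightarrow> F \<in> flags \<Longrightarrow> image_flag g F \<in> flags"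
  by (auto simp: flags_def image_flag_flag map_basis)

lemma image_flag_comp: "image_flag (g \<circ> h) F = image_flag g (image_flag h F)"
  by (simp add: image_flag_def image_comp)

lemma image_flag_id [simp]: "image_flag id F = F"
  by (simp add: image_flag_def)

lemma ex_GL_map:
  assumes vs: "ordered_basis scale vs" and ws: "ordered_basis scale ws"
  shows "\<exists>g\<in>carrier G. map g vs = ws"
proof -
  interpret vector_space_pair scale scale ..
  have len: "length vs = length ws" using length_n[OF vs] length_n[OF ws] by simp
  define f where "f v = the (map_of (zip vs ws) v)" for v
  have f: "map f vs = ws"
    using len basisD(1)[OF vs] by (auto simp: f_def map_of_zip_nth intro!: nth_equalityI)
  obtain g where g: "Vector_Spaces.linear scale scale g" "\<forall>x\<in>set vs. g x = f x"
    "range g = span (f ` set vs)"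
    using linear_independent_extend_subspace[OF basisD(2)[OF vs], of f] by blast
  have "f ` set vs = set ws" using f by (metis set_map)
  then have "surj g" using g(3) basisD(3)[OF ws] by simp
  then have "bij g" using finite_UNIV_surj_inj[OF finite_UNIV] by (auto simp: bij_def)
  moreover have "map g vs = ws" using f g(2) by (metis map_eq_conv)
  ultimately show ?thesis using g(1) by (auto simp: GL_iff)
qed

section \<open>Steps of a flag\<close>

lemma flag_mono: "i \<le> j \<Longrightarrow> flag vs i \<subseteq> flag vs j"
  unfolding flag_def by (intro span_mono set_take_subset_set_take)

lemma flag_0 [simp]: "flag vs 0 = {0}"
  by (simp add: flag_def)

lemma flag_top: "ordered_basis scale vs \<Longrightarrow> i \<ge> n \<Longrightarrow> flag vs i = UNIV"
  using length_n basisD by (auto simp: flag_def)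

lemma flag_Suc: "i < length vs \<Longrightarrow> flag vs (Suc i) = span (insert (vs ! i) (set (take i vs)))"
  by (simp add: flag_def take_Suc_conv_app_nth)

lemma nth_in_flag_Suc: "i < length vs \<Longrightarrow> vs ! i \<in> flag vs (Suc i)"
  by (simp add: flag_Suc span_base)

lemma nth_notin_flag:
  assumes "ordered_basis scale vs" "i < n"
  shows "vs ! i \<notin> flag vs i"
proof -
  have i: "i < length vs" using assms length_n by simp
  have "vs ! i \<notin> set (take i vs)"
    using basisD(1)[OF assms(1)] i by (auto simp: in_set_conv_nth nth_eq_iff_index_eq)
  then have "set (take i vs) \<subseteq> set vs - {vs ! i}"
    using set_take_subset[of i vs] by auto
  moreover have "vs ! i \<notin> span (set vs - {vs ! i})"
    using basisD(2)[OF assms(1)] i by (metis dependent_def nth_mem)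
  ultimately show ?thesis
    using span_mono unfolding flag_def by blast
qed

lemma flagsE:
  assumes "F \<in> flags"
  obtains vs where "ordered_basis scale vs" "F = flag vs" "length vs = n"
  using assms length_n by (auto simp: flags_def)

lemma flags_mono: "F \<in> flags \<Longrightarrow> i \<le> j \<Longrightarrow> F i \<subseteq> F j"
  by (auto simp: flags_def dest: subsetD[OF flag_mono])

lemma flags_0: "F \<in> flags \<Longrightarrow> F 0 = {0}"
  by (auto simp: flags_def)

lemma flags_top: "F \<in> flags \<Longrightarrow> i \<ge> n \<Longrightarrow> F i = UNIV"
  using flag_top by (auto simp: flags_def)

lemma flags_add: "F \<in> flags \<Longrightarrow> x \<in> F i \<Longrightarrow> y \<in> F i \<Longrightarrow> x + y \<in> F i"
  by (auto simp: flags_def flag_def span_add)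

lemma flags_diff: "F \<in> flags \<Longrightarrow> x \<in> F i \<Longrightarrow> y \<in> F i \<Longrightarrow> x - y \<in> F i"
  by (auto simp: flags_def flag_def span_diff)

lemma flags_scale: "F \<in> flags \<Longrightarrow> x \<in> F i \<Longrightarrow> scale c x \<in> F i"
  by (auto simp: flags_def flag_def span_scale)

lemma flags_step_nonempty: "F \<in> flags \<Longrightarrow> i < n \<Longrightarrow> \<exists>v. v \<in> F (Suc i) - F i"
  by (metis Diff_iff flagsE nth_in_flag_Suc nth_notin_flag)

text \<open>Consecutive members differ by a line. The scalar is the quotient of the coordinates of y
  and x along the basis vector of that step.\<close>

lemma flags_step:
  assumes F: "F \<in> flags" and i: "i < n" and x: "x \<in> F (Suc i) - F i" and y: "y \<in> F (Suc i)"
  shows "\<exists>c. y - scale c x \<in> F i"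
proof -
  obtain vs where vs: "F = flag vs" "length vs = n" using F flagsE by metis
  let ?a = "vs ! i"
  obtain k where k: "x - scale k ?a \<in> F i"
    using x i vs by (auto simp: flag_Suc span_breakdown_eq) (auto simp: flag_def)
  obtain l where l: "y - scale l ?a \<in> F i"
    using y i vs by (auto simp: flag_Suc span_breakdown_eq) (auto simp: flag_def)
  have "k \<noteq> 0" using k x by auto
  have "(y - scale l ?a) - scale (l / k) (x - scale k ?a) \<in> F i"
    by (intro flags_diff flags_scale F k l)
  also have "(y - scale l ?a) - scale (l / k) (x - scale k ?a) = y - scale (l / k) x"
    using \<open>k \<noteq> 0\<close> by (simp add: scale_right_diff_distrib)
  finally show ?thesis ..
qed

text \<open>The vector v generates both steps over the common member. The use is contrapositive:
  distinct members of a panel share, at the index where they differ, no vector outside the member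
  below.\<close>

lemma flags_step_eq:
  assumes F: "F \<in> flags" "F' \<in> flags" and i: "i < n" and eq: "F i = F' i"
    and v: "v \<in> F (Suc i)" "v \<in> F' (Suc i)" "v \<notin> F i"
  shows "F (Suc i) = F' (Suc i)"
proof -
  have "E (Suc i) \<subseteq> E' (Suc i)"
    if E: "E \<in> flags" "E' \<in> flags" "E i = E' i" "v \<in> E (Suc i)" "v \<in> E' (Suc i)" "v \<notin> E i" for E E'
  proof
    fix y assume "y \<in> E (Suc i)"
    then obtain c where "y - scale c v \<in> E i" using flags_step[OF E(1) i] E by blast
    then have "y - scale c v \<in> E' (Suc i)" using E flags_mono[of E' i "Suc i"] by auto
    then have "(y - scale c v) + scale c v \<in> E' (Suc i)"
      using E by (intro flags_add flags_scale)
    then show "y \<in> E' (Suc i)" by simp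
  qed
  from this[OF F eq v] this[OF F(2,1) eq[symmetric] v(2,1)] show ?thesis using v eq by auto
qed

text \<open>Since steps are lines, any choice of one vector per step builds up the flag. This
  freedom lets \<open>opposite_basis\<close> choose vectors adapted to two flags at once.\<close>

lemma adapted_basis:
  assumes F: "F \<in> flags" and v: "\<And>i. i < n \<Longrightarrow> v i \<in> F (Suc i) - F i"
  shows "ordered_basis scale (map v [0..<n])" "flag (map v [0..<n]) = F"
proof -
  have ind: "span (v ` {..<k}) = F k \<and> independent (v ` {..<k}) \<and> inj_on v {..<k}" if "k \<le> n" for k
    using that
  proof (induction k)
    case (Suc k)
    then have IH: "span (v ` {..<k}) = F k" "independent (v ` {..<k})" "inj_on v {..<k}" by auto
    have vk: "v k \<notin> span (v ` {..<k})" using v[of k] Suc IH by auto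
    have "x \<in> span (insert (v k) (v ` {..<k})) \<longleftrightarrow> x \<in> F (Suc k)" for x
    proof
      assume "x \<in> F (Suc k)"
      then show "x \<in> span (insert (v k) (v ` {..<k}))"
        using flags_step[OF F _ v, of k x] Suc IH by (simp add: span_breakdown_eq)
    next
      assume "x \<in> span (insert (v k) (v ` {..<k}))"
      then obtain c where "x - scale c (v k) \<in> F k"
        using IH by (auto simp: span_breakdown_eq)
      then have "(x - scale c (v k)) + scale c (v k) \<in> F (Suc k)"
        using v[of k] Suc.prems flags_mono[OF F, of k "Suc k"] by (intro flags_add flags_scale F) auto
      then show "x \<in> F (Suc k)" by simp
    qed
    then show ?case
      using IH vk independent_insertI[of "v k" "v ` {..<k}"] span_base[of "v k" "v ` {..<k}"]
      by (auto simp: lessThan_Suc)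
  qed (simp add: flags_0[OF F] independent_empty)
  have take: "set (take k (map v [0..<n])) = v ` {..<min k n}" for k
    by (auto simp: take_map min_def)
  show "flag (map v [0..<n]) = F"
  proof
    fix k show "flag (map v [0..<n]) k = F k"
      using ind[of "min k n"] flags_top[OF F] unfolding flag_def take by (cases "k \<le> n") auto
  qed
  show "ordered_basis scale (map v [0..<n])"
    using ind[of n] flags_top[OF F, of n]
    by (simp add: ordered_basis_def distinct_map atLeast0LessThan)
qed

section \<open>Relative position to the base flag\<close>

definition base_flag :: "nat \<Rightarrow> 'v set" where "base_flag = flag bs"

lemma base_flag: "base_flag \<in> flags"
  using basis by (auto simp: base_flag_def flags_def)

definition level :: "'v \<Rightarrow> nat" where "level v = (LEAST j. v \<in> base_flag j)"

lemma level_le_iff: "level v \<le> j \<longleftrightarrow> v \<in> base_flag j"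
proof
  have "v \<in> base_flag n" using flags_top[OF base_flag] by simp
  then have "v \<in> base_flag (level v)" unfolding level_def by (rule LeastI)
  then show "level v \<le> j \<Longrightarrow> v \<in> base_flag j" using flags_mono[OF base_flag] by blast
qed (auto simp: level_def intro: Least_le)

lemma level_le_n: "level v \<le> n"
  using flags_top[OF base_flag] by (simp add: level_le_iff)

lemma level_eq_Suc_iff: "level v = Suc j \<longleftrightarrow> v \<in> base_flag (Suc j) - base_flag j"
  by (auto simp flip: level_le_iff)

lemma level_pos_iff: "level v > 0 \<longleftrightarrow> v \<noteq> 0"
  using level_le_iff[of v 0] flags_0[OF base_flag] by auto

lemma level_nth: "i < n \<Longrightarrow> level (bs ! i) = Suc i"
  using nth_in_flag_Suc nth_notin_flag[OF basis]
  by (simp add: level_eq_Suc_iff base_flag_def n_def)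

text \<open>The jumps of \<^term>\<open>base_flag\<close> along \<^term>\<open>F\<close>: up to a shift by one, the permutation that
  records the relative position of the two flags.\<close>

definition jump :: "(nat \<Rightarrow> 'v set) \<Rightarrow> nat \<Rightarrow> nat" where
  "jump F i = (LEAST j. \<exists>v\<in>F (Suc i) - F i. level v = j)"

lemma jump_witness: "F \<in> flags \<Longrightarrow> i < n \<Longrightarrow> \<exists>v\<in>F (Suc i) - F i. level v = jump F i"
  unfolding jump_def by (rule LeastI_ex) (use flags_step_nonempty in blast)

lemma jump_le: "v \<in> F (Suc i) - F i \<Longrightarrow> jump F i \<le> level v"
  unfolding jump_def by (intro Least_le) blast

lemma jump_bounds:
  assumes "F \<in> flags" "i < n"
  shows "0 < jump F i" "jump F i \<le> n"
proof -
  obtain v where v: "v \<in> F (Suc i) - F i" "level v = jump F i"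
    using jump_witness[OF assms] by blast
  moreover have "v \<noteq> 0"
    using v flags_diff[OF assms(1), of v i v] flags_mono[OF assms(1), of 0 i] flags_0[OF assms(1)] by auto
  ultimately show "0 < jump F i" "jump F i \<le> n"
    using level_le_n level_pos_iff by metis+
qed

text \<open>If two steps had minimal vectors of equal level, subtracting a multiple of the lower one
  from the upper one would stay in the upper step and fall below its minimal level.\<close>

lemma jump_inj:
  assumes F: "F \<in> flags"
  shows "inj_on (jump F) {..<n}"
proof -
  have False if ij: "i < j" "j < n" "jump F i = jump F j" for i j
  proof -
    obtain x where x: "x \<in> F (Suc i) - F i" "level x = jump F i"
      using jump_witness[OF F, of i] ij by auto
    obtain y where y: "y \<in> F (Suc j) - F j" "level y = jump F j"
      using jump_witness[OF F, of j] ij by auto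
    obtain l where l: "jump F j = Suc l"
      using jump_bounds(1)[OF F ij(2)] gr0_implies_Suc by blast
    have l_less: "l < n" using jump_bounds(2)[OF F ij(2)] l by simp
    have xy: "x \<in> base_flag (Suc l) - base_flag l" "y \<in> base_flag (Suc l)"
      using x y ij l level_eq_Suc_iff[of x l] level_eq_Suc_iff[of y l] by auto
    obtain c where c: "y - scale c x \<in> base_flag l"
      using flags_step[OF base_flag l_less xy] by blast
    have xj: "scale c x \<in> F j" "scale c x \<in> F (Suc j)"
      using x ij flags_mono[OF F, of "Suc i" j] flags_mono[OF F, of "Suc i" "Suc j"]
      by (auto intro!: flags_scale[OF F])
    then have "y - scale c x \<in> F (Suc j) - F j"
      using y flags_diff[OF F, of y "Suc j" "scale c x"]
        flags_add[OF F, of "y - scale c x" j "scale c x"] by auto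
    then have "Suc l \<le> level (y - scale c x)"
      using jump_le l by metis
    then show False using c by (simp flip: level_le_iff)
  qed
  then show ?thesis
    by (intro inj_onI) (metis lessThan_iff linorder_neqE_nat)
qed

lemma jump_image:
  assumes F: "F \<in> flags"
  shows "jump F ` {..<n} = {1..n}"
proof (rule card_subset_eq)
  show "jump F ` {..<n} \<subseteq> {1..n}"
    using jump_bounds[OF F] by fastforce
qed (simp_all add: card_image[OF jump_inj[OF F]])

text \<open>The jumps run n, n-1, ..., 1: the position of the longest permutation, that is, the big
  cell.\<close>

definition opposite_flags :: "(nat \<Rightarrow> 'v set) set" where
  "opposite_flags = {F \<in> flags. \<forall>i<n. jump F i = n - i}"

text \<open>Without an ascent the jumps decrease strictly within {1..n}: counting down from the
  first bounds them above, counting up from the last bounds them below, and the bounds meet at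
  \<open>n - i\<close>.\<close>

lemma ascent:
  assumes F: "F \<in> flags" "F \<notin> opposite_flags"
  shows "\<exists>i. Suc i < n \<and> jump F i < jump F (Suc i)"
proof (rule ccontr)
  assume "\<not> ?thesis"
  then have desc: "jump F (Suc i) < jump F i" if "Suc i < n" for i
    using that inj_onD[OF jump_inj[OF F(1)], of i "Suc i"]
    by (metis Suc_lessD lessThan_iff linorder_neqE_nat n_not_Suc_n)
  have upper: "jump F i + i \<le> n" if "i < n" for i
    using that
  proof (induction i)
    case (Suc i)
    then show ?case using desc[of i] by simp
  qed (use jump_bounds(2)[OF F(1)] in simp)
  have lower: "k < jump F (n - Suc k)" if "k < n" for k
    using that
  proof (induction k)
    case 0
    then show ?case using jump_bounds(1)[OF F(1), of "n - 1"] by simp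
  next
    case (Suc k)
    then show ?case using desc[of "n - Suc (Suc k)"] by (simp add: Suc_diff_Suc)
  qed
  have "jump F i = n - i" if i: "i < n" for i
    using upper[OF i] lower[of "n - Suc i"] i by (simp add: Suc_diff_Suc)
  then show False using F by (auto simp: opposite_flags_def)
qed

section \<open>Panels and harmonic functions\<close>

definition panel :: "(nat \<Rightarrow> 'v set) \<Rightarrow> nat \<Rightarrow> (nat \<Rightarrow> 'v set) set" where
  "panel F i = {F' \<in> flags. \<forall>j. j \<noteq> i \<longrightarrow> F' j = F j}"

text \<open>A monotone substitute for the length function: interchanging the jumps of an ascent
  shifts the larger jump to the smaller weight and so lowers the sum.\<close>

definition potential :: "(nat \<Rightarrow> 'v set) \<Rightarrow> nat" where
  "potential F = (\<Sum>j<n. j * jump F j)"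

text \<open>At an ascent, every other member of the panel has the two jumps interchanged.\<close>

lemma potential_less:
  assumes F: "F \<in> flags" and i: "Suc i < n" and asc: "jump F i < jump F (Suc i)"
    and F': "F' \<in> panel F (Suc i)" "F' \<noteq> F"
  shows "potential F' < potential F"
proof -
  have F'f: "F' \<in> flags" and eq: "\<And>j. j \<noteq> Suc i \<Longrightarrow> F' j = F j"
    using F' by (auto simp: panel_def)
  have neq: "F' (Suc i) \<noteq> F (Suc i)" using F'(2) eq by (metis ext)
  have other: "jump F' j = jump F j" if "j \<noteq> i" "j \<noteq> Suc i" for j
    using that eq by (simp add: jump_def)
  have ge: "jump F (Suc i) \<le> jump F' i"
  proof -
    obtain v where v: "v \<in> F' (Suc i) - F' i" "level v = jump F' i"
      using jump_witness[OF F'f, of i] i by auto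
    have "v \<in> F (Suc (Suc i))"
      using v eq[of "Suc (Suc i)"] flags_mono[OF F'f, of "Suc i" "Suc (Suc i)"] by auto
    moreover have "v \<notin> F (Suc i)"
      using flags_step_eq[OF F F'f, of i v] i eq[of i] v neq by auto
    ultimately show ?thesis using jump_le v by (metis DiffI)
  qed
  \<comment> \<open>A minimal vector of step i of F cannot lie in \<open>F' (Suc i)\<close>, or the
    flags would agree there; so it lies in the next step of F' and bounds the jump of that
    step.\<close>
  have le: "jump F' (Suc i) \<le> jump F i"
  proof -
    obtain v where v: "v \<in> F (Suc i) - F i" "level v = jump F i"
      using jump_witness[OF F, of i] i by auto
    have "v \<in> F' (Suc (Suc i))"
      using v eq[of "Suc (Suc i)"] flags_mono[OF F, of "Suc i" "Suc (Suc i)"] by auto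
    moreover have "v \<notin> F' (Suc i)"
      using flags_step_eq[OF F F'f, of i v] i eq[of i] v neq by auto
    ultimately show ?thesis using jump_le v by (metis DiffI)
  qed
  let ?R = "{..<n} - {i, Suc i}"
  have split: "(\<Sum>j<n. f j) = f i + f (Suc i) + (\<Sum>j\<in>?R. f j)" for f :: "nat \<Rightarrow> nat"
  proof -
    have "{..<n} = {i, Suc i} \<union> ?R" using i by auto
    then have "(\<Sum>j<n. f j) = (\<Sum>j\<in>{i, Suc i} \<union> ?R. f j)" by simp
    also have "\<dots> = (\<Sum>j\<in>{i, Suc i}. f j) + (\<Sum>j\<in>?R. f j)" by (rule sum.union_disjoint) auto
    finally show ?thesis by simp
  qed
  have total: "(\<Sum>j<n. jump E j) = \<Sum>{1..n}" if "E \<in> flags" for E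
    using sum.reindex[OF jump_inj[OF that], of "\<lambda>x. x"] jump_image[OF that] by simp
  have R: "(\<Sum>j\<in>?R. jump F' j) = (\<Sum>j\<in>?R. jump F j)" "(\<Sum>j\<in>?R. j * jump F' j) = (\<Sum>j\<in>?R. j * jump F j)"
    by (auto intro!: sum.cong simp: other)
  \<comment> \<open>The jumps of every flag exhaust {1..n} and the others agree, so these two have
    the same total; the weighted sum then depends only on the jump at \<open>Suc i\<close>.\<close>
  have sum2: "jump F' i + jump F' (Suc i) = jump F i + jump F (Suc i)"
    using total[OF F] total[OF F'f] split[of "jump F"] split[of "jump F'"] R by simp
  have "i * jump F' i + Suc i * jump F' (Suc i) = i * (jump F' i + jump F' (Suc i)) + jump F' (Suc i)"
    by (simp add: algebra_simps)
  also have "\<dots> < i * (jump F i + jump F (Suc i)) + jump F (Suc i)"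
    unfolding sum2 using le asc by simp
  also have "\<dots> = i * jump F i + Suc i * jump F (Suc i)"
    by (simp add: algebra_simps)
  finally show ?thesis
    unfolding potential_def using split[of "\<lambda>j. j * jump F j"] split[of "\<lambda>j. j * jump F' j"] R by simp
qed

text \<open>Up to values off \<open>flags\<close>, the top reduced homology of the Tits building:
  the panel sums are the boundary. The members at 0 and n are the same in all flags and define no
  panels.\<close>

definition harmonic :: "((nat \<Rightarrow> 'v set) \<Rightarrow> complex) set" where
  "harmonic = {f. \<forall>F\<in>flags. \<forall>i. 0 < i \<and> i < n \<longrightarrow> (\<Sum>F'\<in>panel F i. f F') = 0}"

lemma finite_panel: "finite (panel F i)"
  using finite_flags by (simp add: panel_def)

text \<open>At an ascent all other members of the panel have smaller potential, so by induction F
  alone can contribute to a panel sum that is zero.\<close>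

lemma harmonic_inj:
  assumes f: "f \<in> harmonic" and zero: "\<forall>F\<in>opposite_flags. f F = 0" and F: "F \<in> flags"
  shows "f F = 0"
  using F
proof (induction "potential F" arbitrary: F rule: less_induct)
  case less
  show ?case
  proof (cases "F \<in> opposite_flags")
    case False
    then obtain i where i: "Suc i < n" "jump F i < jump F (Suc i)"
      using ascent less.prems by blast
    have self: "F \<in> panel F (Suc i)" using less.prems by (simp add: panel_def)
    have "f F' = 0" if "F' \<in> panel F (Suc i) - {F}" for F'
      using less.hyps[OF potential_less[OF less.prems i]] that by (auto simp: panel_def)
    then have "(\<Sum>F'\<in>panel F (Suc i). f F') = f F"
      using sum.remove[OF finite_panel self, of f] by simp
    then show ?thesis using f less.prems i by (auto simp: harmonic_def)
  qed (use zero in blast)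
qed

lemma harmonic_image_flag:
  assumes f: "f \<in> harmonic" and g: "g \<in> carrier G"
  shows "(\<lambda>F. f (image_flag g F)) \<in> harmonic"
  unfolding harmonic_def
proof (intro CollectI ballI allI impI)
  fix F i assume F: "F \<in> flags" and i: "0 < i \<and> i < n"
  let ?h = "inv\<^bsub>G\<^esub> g"
  have h: "?h \<in> carrier G" "?h \<circ> g = id" "g \<circ> ?h = id" using g G.l_inv[OF g] G.r_inv[OF g] by auto
  have panel: "image_flag k E' \<in> panel (image_flag k E) i" if "E' \<in> panel E i" "k \<in> carrier G" for E E' k
    using that image_flag_closed by (auto simp: panel_def image_flag_def)
  have "(\<Sum>F'\<in>panel F i. f (image_flag g F')) = (\<Sum>F'\<in>panel (image_flag g F) i. f F')"
    by (rule sum.reindex_bij_witness[of _ "image_flag ?h" "image_flag g"])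
      (use h g panel[of _ F] panel[of _ "image_flag g F" ?h] in \<open>simp_all flip: image_flag_comp\<close>)
  also have "\<dots> = 0"
    using f image_flag_closed[OF g F] i by (auto simp: harmonic_def)
  finally show "(\<Sum>F'\<in>panel F i. f (image_flag g F')) = 0" .
qed

section \<open>Opposite flags and apartments\<close>

lemma jump_image_flag:
  assumes b: "b \<in> carrier G" "image_flag b base_flag = base_flag"
  shows "jump (image_flag b F) i = jump F i"
proof -
  have inj: "inj b" using b by (auto simp: GL_iff bij_def)
  have "b v \<in> base_flag j \<longleftrightarrow> v \<in> base_flag j" for v j
    using inj_image_mem_iff[OF inj, of v "base_flag j"] b(2) unfolding image_flag_def by metis
  then have level: "level (b v) = level v" for v
    by (simp add: level_def)
  have "image_flag b F (Suc i) - image_flag b F i = b ` (F (Suc i) - F i)"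
    by (simp add: image_flag_def image_set_diff[OF inj])
  then show ?thesis by (simp add: jump_def level)
qed

text \<open>The minimal vectors of the steps of F have levels n, ..., 1; read backwards they pick
  one vector from each step of the base flag too.\<close>

lemma opposite_basis:
  assumes "F \<in> opposite_flags"
  obtains vs where "ordered_basis scale vs" "flag vs = F" "flag (rev vs) = base_flag"
    "\<And>i. i < n \<Longrightarrow> level (vs ! i) = n - i" "length vs = n"
proof -
  have F: "F \<in> flags" "\<And>i. i < n \<Longrightarrow> jump F i = n - i"
    using assms by (auto simp: opposite_flags_def)
  obtain v where v: "\<And>i. i < n \<Longrightarrow> v i \<in> F (Suc i) - F i" "\<And>i. i < n \<Longrightarrow> level (v i) = n - i"
    using jump_witness[OF F(1)] F(2) by metis
  have "v (n - Suc i) \<in> base_flag (Suc i) - base_flag i" if "i < n" for i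
    using v(2)[of "n - Suc i"] that level_eq_Suc_iff[of "v (n - Suc i)" i] by simp
  then have "flag (map (\<lambda>i. v (n - Suc i)) [0..<n]) = base_flag"
    by (intro adapted_basis base_flag)
  also have "map (\<lambda>i. v (n - Suc i)) [0..<n] = rev (map v [0..<n])"
    by (intro nth_equalityI) (auto simp: rev_nth)
  finally show thesis
    using adapted_basis[OF F(1) v(1)] v(2) by (intro that[of "map v [0..<n]"]) auto
qed

lemma rev_basis: "ordered_basis scale vs \<Longrightarrow> ordered_basis scale (rev vs)"
  by (simp add: ordered_basis_def)

lemma opposite_image:
  assumes "F \<in> opposite_flags"
  shows "\<exists>b\<in>carrier G. image_flag b base_flag = base_flag \<and> image_flag b (flag (rev bs)) = F"
proof -
  obtain vs where vs: "ordered_basis scale vs" "flag vs = F" "flag (rev vs) = base_flag"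
    using opposite_basis[OF assms] by metis
  \<comment> \<open>With \<open>rev vs\<close> as target, \<open>bs\<close> goes to a basis of the
    base flag, and its reversal to a basis of F.\<close>
  obtain g where g: "g \<in> carrier G" "map g bs = rev vs"
    using ex_GL_map[OF basis rev_basis[OF vs(1)]] by blast
  then show ?thesis
    using vs by (intro bexI[of _ g]) (auto simp: base_flag_def image_flag_flag simp flip: rev_map)
qed

lemma opposite_transitive:
  assumes "x \<in> opposite_flags" "y \<in> opposite_flags"
  shows "\<exists>b\<in>carrier G. image_flag b base_flag = base_flag \<and> y = image_flag b x"
proof -
  obtain b where b: "b \<in> carrier G" "image_flag b base_flag = base_flag" "image_flag b (flag (rev bs)) = x"
    using opposite_image[OF assms(1)] by blast
  obtain c where c: "c \<in> carrier G" "image_flag c base_flag = base_flag" "image_flag c (flag (rev bs)) = y"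
    using opposite_image[OF assms(2)] by blast
  let ?i = "inv\<^bsub>G\<^esub> b"
  have i: "?i \<in> carrier G" "?i \<circ> b = id" using b G.l_inv[OF b(1)] by auto
  have "image_flag ?i base_flag = base_flag" "image_flag ?i x = flag (rev bs)"
    using b(2,3) i(2) image_flag_comp[of ?i b] image_flag_id by metis+
  then show ?thesis
    using b c i G.m_closed[OF c(1) i(1)] by (intro bexI[of _ "c \<circ> ?i"]) (auto simp: image_flag_comp)
qed

text \<open>If a vector of the step had lower level than \<open>vs ! i\<close>, both it and the
  remainder of \<open>vs ! i\<close> modulo it would lie in the span of the other basis vectors,
  against independence. The jumps of an apartment flag therefore spell out its permutation.\<close>

lemma jump_apartment:
  assumes vs: "distinct vs" "set vs = set bs" and i: "i < n"
  shows "jump (flag vs) i = level (vs ! i)"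
proof (rule antisym)
  have basis_vs: "ordered_basis scale vs" using vs basis by (simp add: ordered_basis_def)
  have F: "flag vs \<in> flags" using basis_vs by (auto simp: flags_def)
  have len: "length vs = n" using length_n[OF basis_vs] .
  show "jump (flag vs) i \<le> level (vs ! i)"
    using nth_in_flag_Suc[of i vs] nth_notin_flag[OF basis_vs i] len i by (intro jump_le) auto
  obtain v where v: "v \<in> flag vs (Suc i) - flag vs i" "level v = jump (flag vs) i"
    using jump_witness[OF F i] by blast
  have "vs ! i \<in> set bs" using vs i len by (metis nth_mem)
  then obtain p where p: "p < n" "vs ! i = bs ! p" by (auto simp: in_set_conv_nth n_def)
  show "level (vs ! i) \<le> jump (flag vs) i"
  proof (rule ccontr)
    assume "\<not> ?thesis"
    then have lv: "level v \<le> p" using v p level_nth by simp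
    let ?S = "set bs - {vs ! i}"
    obtain c where c: "vs ! i - scale c v \<in> flag vs i"
      using flags_step[OF F i v(1) nth_in_flag_Suc] len i by auto
    have "v \<in> span (set (take p bs))"
      using lv by (simp add: level_le_iff base_flag_def flag_def)
    moreover have "set (take p bs) \<subseteq> ?S"
      using p basisD(1)[OF basis] set_take_subset[of p bs]
      by (auto simp: in_set_conv_nth nth_eq_iff_index_eq n_def)
    moreover have "set (take i vs) \<subseteq> ?S"
      using vs i len set_take_subset[of i vs] by (auto simp: in_set_conv_nth nth_eq_iff_index_eq)
    ultimately have "v \<in> span ?S" "vs ! i - scale c v \<in> span ?S"
      using c span_mono unfolding flag_def by blast+
    then have "(vs ! i - scale c v) + scale c v \<in> span ?S"
      by (intro span_add span_scale)
    then show False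
      using basisD(2)[OF basis] \<open>vs ! i \<in> set bs\<close> by (auto simp: dependent_def)
  qed
qed

text \<open>The homology cycle of the apartment of \<open>bs\<close>. Starting from
  \<open>rev bs\<close> gives the opposite flag to the identity permutation, whose sign is
  1.\<close>

definition apartment_sum :: "(nat \<Rightarrow> 'v set) \<Rightarrow> complex" where
  "apartment_sum F = (\<Sum>p | p permutes {..<n}.
     of_int (sign p) * (if flag (permute_list p (rev bs)) = F then 1 else 0))"

lemma permute_list_basis:
  assumes "p permutes {..<n}"
  shows "distinct (permute_list p (rev bs))" "set (permute_list p (rev bs)) = set bs"
    "ordered_basis scale (permute_list p (rev bs))"
  using assms basisD(1)[OF basis] basis by (auto simp: n_def ordered_basis_def)

text \<open>Every prefix of length other than \<open>Suc i\<close> contains both of the interchanged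
  entries or neither.\<close>

lemma flag_permute_transpose:
  assumes "length ys = n" "Suc i < n" "j \<noteq> Suc i"
  shows "flag (permute_list (Transposition.transpose i (Suc i)) ys) j = flag ys j"
proof -
  let ?t = "Transposition.transpose i (Suc i)"
  have t: "?t permutes {..<length ys}" using assms by (intro permutes_swap_id) auto
  show ?thesis
  proof (cases "j \<le> n")
    case True
    have "?t ` {..<j} = {..<j}"
      using assms(3) by (auto simp: Transposition.transpose_def image_iff)
    have "set (take j (permute_list ?t ys)) = (\<lambda>k. ys ! ?t k) ` {..<j}"
      using nth_image[of j "permute_list ?t ys"] True assms t
      by (auto simp: permute_list_nth lessThan_atLeast0 image_iff)
    also have "\<dots> = (!) ys ` (?t ` {..<j})" by (simp add: image_image)
    also have "\<dots> = set (take j ys)"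
      using nth_image[of j ys] True assms \<open>?t ` {..<j} = {..<j}\<close> by (simp add: lessThan_atLeast0)
    finally show ?thesis by (simp add: flag_def)
  next
    case False
    then show ?thesis using assms t by (simp add: flag_def)
  qed
qed

text \<open>Composition with the transposition of i and \<open>Suc i\<close> preserves membership in
  the panel and reverses the sign, so the panel sum is its own negative.\<close>

lemma apartment_sum_harmonic: "apartment_sum \<in> harmonic"
  unfolding harmonic_def
proof (intro CollectI ballI allI impI)
  fix F i0 assume F: "F \<in> flags" and i0: "0 < i0 \<and> i0 < n"
  then obtain i where i: "i0 = Suc i" "Suc i < n" by (metis gr0_implies_Suc)
  let ?P = "{p. p permutes {..<n}}"
  let ?t = "Transposition.transpose i (Suc i)"
  define c where "c p = (of_int (sign p) * (if flag (permute_list p (rev bs)) \<in> panel F i0 then 1 else 0) :: complex)" for p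
  have t: "?t permutes {..<n}" using i by (intro permutes_swap_id) auto
  have eq: "(\<Sum>F'\<in>panel F i0. apartment_sum F') = (\<Sum>p\<in>?P. c p)"
    unfolding apartment_sum_def c_def
    by (subst sum.swap) (auto simp: finite_panel sum_distrib_left[symmetric] intro!: sum.cong)
  have "(\<Sum>p\<in>?P. c p) = (\<Sum>p\<in>?P. c (p \<circ> ?t))"
    using t by (intro sum.reindex_bij_witness[of _ "\<lambda>p. p \<circ> ?t" "\<lambda>p. p \<circ> ?t"])
      (auto simp: comp_assoc permutes_compose)
  also have "\<dots> = (\<Sum>p\<in>?P. - c p)"
  proof (rule sum.cong[OF HOL.refl])
    fix p assume "p \<in> ?P"
    then have p: "p permutes {..<n}" by simp
    have "sign (p \<circ> ?t) = - sign p"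
      using p t by (simp add: sign_compose permutes_imp_permutation[of "{..<n}"] sign_swap_id)
    moreover have "flag (permute_list (p \<circ> ?t) (rev bs)) \<in> panel F i0 \<longleftrightarrow> flag (permute_list p (rev bs)) \<in> panel F i0"
    proof -
      have "permute_list (p \<circ> ?t) (rev bs) = permute_list ?t (permute_list p (rev bs))"
        using t by (intro permute_list_compose) (simp add: n_def)
      moreover have "flag (permute_list (p \<circ> ?t) (rev bs)) \<in> flags" "flag (permute_list p (rev bs)) \<in> flags"
        using permute_list_basis(3)[OF p] permute_list_basis(3)[OF permutes_compose[OF t p]]
        by (auto simp: flags_def)
      ultimately show ?thesis
        using flag_permute_transpose[of "permute_list p (rev bs)" i] i by (auto simp: panel_def n_def)
    qed
    ultimately show "c (p \<circ> ?t) = - c p" by (simp add: c_def)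
  qed
  finally have "(\<Sum>p\<in>?P. c p) + (\<Sum>p\<in>?P. c p) = 0"
    by (simp add: sum_negf eq_neg_iff_add_eq_0)
  then show "(\<Sum>F'\<in>panel F i0. apartment_sum F') = 0"
    unfolding eq by simp
qed

lemma opposite_rev: "flag (rev bs) \<in> opposite_flags"
proof -
  have "jump (flag (rev bs)) i = n - i" if "i < n" for i
    using jump_apartment[of "rev bs" i] level_nth[of "n - Suc i"] that basisD(1)[OF basis]
    by (simp add: rev_nth n_def)
  then show ?thesis
    using rev_basis[OF basis] by (auto simp: opposite_flags_def flags_def)
qed

text \<open>By \<open>jump_apartment\<close> a permutation can be recovered from the jumps of its
  flag, and decreasing jumps belong to the identity.\<close>

lemma apartment_sum_opposite:
  assumes F: "F \<in> opposite_flags"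
  shows "apartment_sum F = (if F = flag (rev bs) then 1 else 0)"
proof -
  have id: "p = id" if p: "p permutes {..<n}" and eq: "flag (permute_list p (rev bs)) = F" for p
  proof
    fix i show "p i = id i"
    proof (cases "i < n")
      case True
      have pi: "p i < n" using p True permutes_in_image by fastforce
      have "n - i = level (permute_list p (rev bs) ! i)"
        using F eq jump_apartment[OF permute_list_basis(1,2)[OF p] True] True
        by (auto simp: opposite_flags_def)
      also have "\<dots> = level (bs ! (n - Suc (p i)))"
        using True pi p by (simp add: permute_list_nth rev_nth n_def)
      also have "\<dots> = n - p i"
        using pi by (simp add: level_nth Suc_diff_Suc)
      finally show ?thesis using True pi by simp
    qed (use p permutes_not_in[of p "{..<n}" i] in simp)
  qed
  have "apartment_sum F = (\<Sum>p | p permutes {..<n}. if p = id then (if flag (rev bs) = F then 1 else 0) else 0)"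
    unfolding apartment_sum_def
  proof (rule sum.cong[OF HOL.refl], goal_cases)
    case (1 p)
    then show ?case using id[of p] by (cases "p = id") (auto simp: sign_id)
  qed
  also have "\<dots> = (if F = flag (rev bs) then 1 else 0)"
    by (simp add: finite_permutations permutes_id)
  finally show ?thesis .
qed

sublocale cell: cell_action G image_flag flags opposite_flags base_flag harmonic
proof (intro cell_action.intro group_GL cell_action_axioms.intro)
  show "finite (carrier G)" by (rule finite_GL)
  show "image_flag g y \<in> flags" if "g \<in> carrier G" "y \<in> flags" for g y
    using that by (rule image_flag_closed)
  show "\<exists>g\<in>carrier G. y = image_flag g base_flag" if "y \<in> flags" for y
    using that ex_GL_map[OF basis] unfolding flags_def base_flag_def
    by (auto simp: image_flag_flag)
  show "image_flag b x \<in> opposite_flags"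
    if "b \<in> carrier G" "image_flag b base_flag = base_flag" "x \<in> opposite_flags" for b x
    using that by (simp add: opposite_flags_def image_flag_closed jump_image_flag)
  show "\<exists>b\<in>carrier G. image_flag b base_flag = base_flag \<and> y = image_flag b x"
    if "x \<in> opposite_flags" "y \<in> opposite_flags" for x y
    using that by (rule opposite_transitive)
  show "(\<lambda>y. f (image_flag g y)) \<in> harmonic" if "f \<in> harmonic" "g \<in> carrier G" for f g
    using that by (rule harmonic_image_flag)
  show "f y = 0" if "f \<in> harmonic" "\<forall>x\<in>opposite_flags. f x = 0" "y \<in> flags" for f y
    using that by (rule harmonic_inj)
  show "\<exists>x\<in>opposite_flags. \<exists>f\<in>harmonic. f x = 1 \<and> (\<forall>y\<in>opposite_flags - {x}. f y = 0)"
    by (rule bexI[OF _ opposite_rev], rule bexI[OF _ apartment_sum_harmonic])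
      (simp add: apartment_sum_opposite opposite_rev)
  show "finite opposite_flags" using finite_flags by (simp add: opposite_flags_def)
  show "opposite_flags \<noteq> {}" using opposite_rev by blast
  show "(\<lambda>y. c * f y) \<in> harmonic" if "f \<in> harmonic" for f c
    using that by (simp add: harmonic_def sum_distrib_left[symmetric])
qed (auto simp: opposite_flags_def base_flag image_flag_comp harmonic_def sum.distrib)

end

section \<open>Polynomials in an operator\<close>

text \<open>A divisor of least positive degree cannot split into two factors of positive
  degree.\<close>

lemma monic_irreducible_divisor:
  fixes p :: "'k::field poly"
  assumes "degree p > 0"
  obtains r where "Factorial_Ring.irreducible r" "lead_coeff r = 1" "r dvd p"
proof -
  define P where "P d \<longleftrightarrow> (\<exists>r. r dvd p \<and> degree r = d \<and> d > 0)" for d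
  have "P (degree p)" using assms dvd_refl[of p] unfolding P_def by blast
  then have "P (LEAST d. P d)" by (rule LeastI)
  then obtain r where r: "r dvd p" "degree r = (LEAST d. P d)" "degree r > 0"
    by (auto simp: P_def)
  have min: "degree r \<le> degree s" if "s dvd p" "degree s > 0" for s
    unfolding r(2) using that by (intro Least_le) (auto simp: P_def)
  have r0: "r \<noteq> 0" "lead_coeff r \<noteq> 0" using r(3) by auto
  define s where "s = Polynomial.smult (inverse (lead_coeff r)) r"
  have s: "s dvd p" "degree s = degree r" "lead_coeff s = 1" "s \<noteq> 0"
    using r(1) r0 by (simp_all add: s_def smult_dvd_iff)
  have "Factorial_Ring.irreducible s"
  proof (rule irreducibleI)
    show "s \<noteq> 0" by fact
    show "\<not> s dvd 1" using s r(3) by (auto simp: is_unit_iff_degree)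
    fix a b assume ab: "s = a * b"
    then have nz: "a \<noteq> 0" "b \<noteq> 0" using s by auto
    have deg: "degree a + degree b = degree s" using ab nz by (simp add: degree_mult_eq)
    have "a dvd p" "b dvd p" using ab s(1) by (auto intro: dvd_mult_left dvd_mult_right)
    then have "degree a = 0 \<or> degree b = 0"
      using min[of a] min[of b] deg s(2) by linarith
    then show "a dvd 1 \<or> b dvd 1" using nz by (auto simp: is_unit_iff_degree)
  qed
  then show thesis using that s by blast
qed

lemma monic_prime_power:
  fixes p :: "'k::field poly"
  assumes "lead_coeff p = 1"
    and "\<And>r. Factorial_Ring.irreducible r \<Longrightarrow> lead_coeff r = 1 \<Longrightarrow> r dvd p \<Longrightarrow> r = l"
  shows "\<exists>N. p = l ^ N"
  using assms
proof (induction "degree p" arbitrary: p rule: less_induct)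
  case less
  show ?case
  proof (cases "degree p = 0")
    case True
    then have "p = 1" using less.prems(1) by (auto elim!: degree_eq_zeroE)
    then show ?thesis by (intro exI[of _ 0]) simp
  next
    case False
    then obtain r where r: "Factorial_Ring.irreducible r" "lead_coeff r = 1" "r dvd p"
      using monic_irreducible_divisor[of p] by auto
    then obtain s where s: "p = l * s" "r = l" using less.prems(2) by (metis dvdE)
    have l: "l \<noteq> 0" "degree l > 0" "lead_coeff l = 1"
      using r s(2) by (auto simp: Factorial_Ring.irreducible_def is_unit_iff_degree)
    have s': "lead_coeff s = 1" "s \<noteq> 0"
      using less.prems(1) s l by (auto simp: lead_coeff_mult)
    have "degree s < degree p" using s s' l by (simp add: degree_mult_eq)
    moreover have "r = l" if "Factorial_Ring.irreducible r" "lead_coeff r = 1" "r dvd s" for r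
      using less.prems(2)[OF that(1,2)] that(3) s(1) by auto
    ultimately obtain N where "s = l ^ N" using less.hyps[of s] s' by blast
    then show ?thesis using s(1) by (metis power_Suc)
  qed
qed

context vector_space
begin

context
  fixes f assumes f: "Vector_Spaces.linear scale scale f"
begin

interpretation f: Vector_Spaces.linear scale scale f by (rule f)

text \<open>Frees the sum from the exact degree, which can drop under addition and scaling.\<close>

lemma poly_operator_bound:
  "degree p \<le> m \<Longrightarrow> poly_operator scale p f v = (\<Sum>i\<le>m. scale (coeff p i) ((f ^^ i) v))"
  unfolding poly_operator_def
  by (intro sum.mono_neutral_left) (auto simp: coeff_eq_0 not_le)

lemma poly_operator_0 [simp]: "poly_operator scale 0 f v = 0"
  by (simp add: poly_operator_def)

lemma poly_operator_pCons [simp]: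
  "poly_operator scale (pCons a p) f v = scale a v + f (poly_operator scale p f v)"
proof -
  have "poly_operator scale (pCons a p) f v =
      (\<Sum>i\<le>Suc (degree p). scale (coeff (pCons a p) i) ((f ^^ i) v))"
    by (intro poly_operator_bound degree_pCons_le)
  also have "\<dots> = scale a v + f (poly_operator scale p f v)"
    unfolding sum.atMost_Suc_shift by (simp add: poly_operator_def f.sum f.scale)
  finally show ?thesis .
qed

lemma poly_operator_add:
  "poly_operator scale (p + q) f v = poly_operator scale p f v + poly_operator scale q f v"
proof -
  let ?m = "max (degree p) (degree q)"
  show ?thesis
    using degree_add_le_max[of p q]
    by (simp add: poly_operator_bound[of _ ?m] scale_left_distrib sum.distrib)
qed

lemma poly_operator_smult: "poly_operator scale (Polynomial.smult a p) f v = scale a (poly_operator scale p f v)"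
  using degree_smult_le[of a p]
  by (simp add: poly_operator_bound[of _ "degree p"] scale_sum_right)

lemma poly_operator_diff:
  "poly_operator scale (p - q) f v = poly_operator scale p f v - poly_operator scale q f v"
  using poly_operator_add[of p "Polynomial.smult (-1) q" v] poly_operator_smult[of "-1" q v] by simp

lemma poly_operator_mult:
  "poly_operator scale (p * q) f v = poly_operator scale p f (poly_operator scale q f v)"
  by (induction p) (simp_all add: poly_operator_add poly_operator_smult)

lemma poly_operator_monom: "poly_operator scale (monom 1 i) f v = (f ^^ i) v"
  by (induction i) (simp_all add: monom_0 monom_Suc f.zero)

lemma poly_operator_zero_vec: "poly_operator scale p f 0 = 0"
  by (induction p) (simp_all add: f.zero)

text \<open>On a finite space two powers of f coincide, so a difference of two monomials
  annihilates. A monic annihilator of least degree divides all others by division with remainder,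
  which settles the \<open>THE\<close> in the definition.\<close>

lemma minimal_polynomial:
  assumes fin: "finite (UNIV :: 'b set)"
  shows "lead_coeff (minimal_polynomial scale f) = 1"
    and "poly_operator scale (minimal_polynomial scale f) f v = 0"
    and "(\<And>v. poly_operator scale r f v = 0) \<Longrightarrow> minimal_polynomial scale f dvd r"
proof -
  define A where "A p \<longleftrightarrow> (\<forall>v. poly_operator scale p f v = 0)" for p
  have "\<not> inj (\<lambda>i. f ^^ i)"
  proof
    assume "inj (\<lambda>i. f ^^ i)"
    moreover have "finite (UNIV \<rightarrow>\<^sub>E UNIV :: ('b \<Rightarrow> 'b) set)"
      by (intro finite_PiE) (auto simp: fin)
    ultimately have "finite (UNIV :: nat set)"
      by (metis PiE_UNIV_domain Pi_UNIV finite_subset inj_on_finite subset_UNIV)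
    then show False by simp
  qed
  then obtain i j where ij: "i < j" "f ^^ i = f ^^ j"
    by (metis injI linorder_neqE_nat)
  define p0 where "p0 = (monom 1 j - monom 1 i :: 'a poly)"
  have "coeff p0 j \<noteq> 0" using ij(1) by (simp add: p0_def)
  then have p0: "p0 \<noteq> 0" "A p0"
    using ij(2) by auto (simp add: A_def p0_def poly_operator_diff poly_operator_monom)
  define P where "P d \<longleftrightarrow> (\<exists>p. p \<noteq> 0 \<and> A p \<and> degree p = d)" for d
  have "P (degree p0)" using p0 by (auto simp: P_def)
  then have "P (LEAST d. P d)" by (rule LeastI)
  then obtain p where p: "p \<noteq> 0" "A p" "degree p = (LEAST d. P d)" by (auto simp: P_def)
  have min: "degree p \<le> degree r" if "r \<noteq> 0" "A r" for r
    unfolding p(3) using that by (intro Least_le) (auto simp: P_def)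
  define \<mu> where "\<mu> = Polynomial.smult (inverse (lead_coeff p)) p"
  have "lead_coeff p \<noteq> 0" using p(1) by simp
  then have \<mu>: "lead_coeff \<mu> = 1" "A \<mu>" "degree \<mu> = degree p" "\<mu> \<noteq> 0"
    using p(1,2) by (simp_all add: \<mu>_def A_def poly_operator_smult)
  have dvd: "\<mu> dvd r" if "A r" for r
  proof -
    have "r mod \<mu> = r - (r div \<mu>) * \<mu>" by (simp add: minus_div_mult_eq_mod)
    then have "A (r mod \<mu>)"
      using that \<mu>(2) by (simp add: A_def poly_operator_diff poly_operator_mult poly_operator_zero_vec)
    then have "r mod \<mu> = 0"
      using min[of "r mod \<mu>"] degree_mod_less[OF \<mu>(4), of r] \<mu>(3) by (metis not_le)
    then show ?thesis by (simp add: dvd_eq_mod_eq_0)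
  qed
  have "minimal_polynomial scale f = \<mu>"
    unfolding minimal_polynomial_def
  proof (rule the_equality)
    show "lead_coeff \<mu> = 1 \<and> (\<forall>v. poly_operator scale \<mu> f v = 0) \<and>
        (\<forall>r. (\<forall>v. poly_operator scale r f v = 0) \<longrightarrow> \<mu> dvd r)"
      using \<mu> dvd by (auto simp: A_def)
    fix p assume "lead_coeff p = 1 \<and> (\<forall>v. poly_operator scale p f v = 0) \<and>
        (\<forall>r. (\<forall>v. poly_operator scale r f v = 0) \<longrightarrow> p dvd r)"
    then have p: "lead_coeff p = 1" "p dvd \<mu>" "\<mu> dvd p" using \<mu> dvd by (auto simp: A_def)
    then obtain c where c: "p = \<mu> * c" by (auto elim: dvdE)
    have "p \<noteq> 0" using p(1) by auto
    then have "degree p = degree \<mu>" using p(2,3) \<mu>(4) by (meson dvd_imp_degree_le order_antisym)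
    then have "degree c = 0" using c \<open>p \<noteq> 0\<close> \<mu>(4) by (auto simp: degree_mult_eq)
    moreover have "lead_coeff c = 1" using p(1) \<mu>(1) c by (simp add: lead_coeff_mult)
    ultimately have "c = 1" by (auto elim!: degree_eq_zeroE)
    then show "p = \<mu>" using c by simp
  qed
  then show "lead_coeff (minimal_polynomial scale f) = 1"
    "poly_operator scale (minimal_polynomial scale f) f v = 0"
    "(\<And>v. poly_operator scale r f v = 0) \<Longrightarrow> minimal_polynomial scale f dvd r"
    using \<mu> dvd by (auto simp: A_def)
qed

end
end

section \<open>Unipotent elements and the Steinberg character\<close>

context flag_space
begin



abbreviation unipotents where "unipotents \<equiv> d_regular_elements scale 1"

text \<open>As 1 divides every degree, X - 1 is the only monic irreducible factor allowed, so the
  minimal polynomial is a power of it; evaluated at y, this power iterates y - id.\<close>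

lemma unipotent_nilpotent:
  assumes "y \<in> unipotents"
  shows "\<exists>N. \<forall>v. ((\<lambda>v. y v - v) ^^ N) v = 0"
proof -
  have y: "Vector_Spaces.linear scale scale y" using assms by (simp add: d_regular_elements_def GL_iff)
  have irr: "r = [:-1, 1:]"
    if "Factorial_Ring.irreducible r" "lead_coeff r = 1" "r dvd minimal_polynomial scale y" for r
    using assms that by (auto simp: d_regular_elements_def)
  obtain N where N: "minimal_polynomial scale y = [:-1, 1:] ^ N"
    using monic_prime_power[OF minimal_polynomial(1)[OF y finite_UNIV] irr] by blast
  have "poly_operator scale ([:-1, 1:] ^ k) y v = ((\<lambda>v. y v - v) ^^ k) v" for k v
  proof (induction k)
    case 0
    have "y 0 = 0" using y by (simp add: Vector_Spaces.linear_iff_module_hom module_hom.zero)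
    then show ?case by (simp add: one_pCons poly_operator_pCons[OF y] poly_operator_0[OF y])
  next
    case (Suc k)
    have "y 0 = 0" using y by (simp add: Vector_Spaces.linear_iff_module_hom module_hom.zero)
    then show ?case using Suc
      by (simp add: poly_operator_diff[OF y] poly_operator_pCons[OF y] poly_operator_0[OF y])
  qed
  then show ?thesis using N minimal_polynomial(2)[OF y finite_UNIV] by metis
qed

lemma id_unipotent:
  assumes "n > 0"
  shows "id \<in> unipotents"
proof -
  interpret vector_space_pair scale scale ..
  have id: "Vector_Spaces.linear scale scale id" by (rule linear_id)
  have dvd: "minimal_polynomial scale id dvd [:-1, 1:]"
    by (rule minimal_polynomial(3)[OF id finite_UNIV])
      (simp add: poly_operator_pCons[OF id] poly_operator_0[OF id])
  have "r = [:-1, 1:]"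
    if r: "Factorial_Ring.irreducible r" "lead_coeff r = 1" "r dvd minimal_polynomial scale id" for r
  proof -
    obtain c where c: "[:-1, 1:] = r * c" using dvd_trans[OF r(3) dvd] by (auto elim: dvdE)
    have nz: "r \<noteq> 0" "c \<noteq> 0" using c by auto
    have "degree r + degree c = 1" using degree_mult_eq[OF nz] c[symmetric] by simp
    moreover have "degree r > 0"
      using r(1) nz by (auto simp: Factorial_Ring.irreducible_def is_unit_iff_degree)
    ultimately have "degree c = 0" by simp
    moreover have "lead_coeff c = 1"
      using lead_coeff_mult[of r c] r(2) c[symmetric] by simp
    ultimately have "c = 1" by (auto elim!: degree_eq_zeroE)
    then show ?thesis using c by simp
  qed
  then show ?thesis
    using id by (auto simp: d_regular_elements_def GL_iff)
qed

text \<open>A longest independent list on which y is unitriangular spans: for v outside its span,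
  the last iterate of v under y - id that is still outside could be appended.\<close>

lemma unipotent_adapted_basis:
  assumes lin: "Vector_Spaces.linear scale scale y"
    and N: "\<forall>v. ((\<lambda>v. y v - v) ^^ N) v = 0"
  obtains vs where "ordered_basis scale vs" "\<And>i. i < n \<Longrightarrow> y (vs ! i) - vs ! i \<in> flag vs i"
proof -
  define P where "P vs \<longleftrightarrow> distinct vs \<and> independent (set vs) \<and>
    (\<forall>i<length vs. y (vs ! i) - vs ! i \<in> span (set (take i vs)))" for vs
  have "P []" by (simp add: P_def independent_empty)
  moreover have "\<forall>vs. P vs \<longrightarrow> length vs < Suc (card (UNIV :: 'v set))"
    by (auto simp: P_def less_Suc_eq_le intro!: card_mono finite_UNIV simp flip: distinct_card)
  ultimately obtain vs where vs: "P vs" "\<And>ws. P ws \<Longrightarrow> length ws \<le> length vs"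
    using ex_has_greatest_nat[of P "[]" length] by blast
  have "span (set vs) = UNIV"
  proof (rule ccontr)
    assume "span (set vs) \<noteq> UNIV"
    then obtain v where v: "v \<notin> span (set vs)" by blast
    let ?M = "\<lambda>v. y v - v"
    have ex: "(?M ^^ N) v \<in> span (set vs)" using N by (simp add: span_zero)
    define k where "k = (LEAST k. (?M ^^ k) v \<in> span (set vs))"
    have k: "(?M ^^ k) v \<in> span (set vs)"
      unfolding k_def by (rule LeastI[where P = "\<lambda>k. (?M ^^ k) v \<in> span (set vs)", OF ex])
    then obtain j where j: "k = Suc j" using v by (cases k) auto
    have u: "(?M ^^ j) v \<notin> span (set vs)"
      using not_less_Least[of j "\<lambda>k. (?M ^^ k) v \<in> span (set vs)"] j by (simp add: k_def)
    let ?u = "(?M ^^ j) v"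
    have "P (vs @ [?u])"
      using vs(1) u k j span_base[of ?u "set vs"] independent_insertI[of ?u "set vs"]
      by (auto simp: P_def nth_append less_Suc_eq)
    from vs(2)[OF this] show False by simp
  qed
  then have "ordered_basis scale vs" using vs(1) by (simp add: P_def ordered_basis_def)
  then show thesis
    using vs(1) length_n by (intro that) (auto simp: P_def flag_def)
qed

text \<open>For \<open>v = vs ! i\<close> the difference b v - v stays in \<open>F (Suc i)\<close>,
  where nonzero vectors have level at least \<open>n - i\<close>. But v has level
  \<open>n - i\<close> and b lowers the level of the difference strictly, so the difference is
  zero.\<close>

lemma fixed_opposite_flag:
  assumes b: "b \<in> carrier G" and down: "\<And>j v. j < n \<Longrightarrow> v \<in> base_flag (Suc j) \<Longrightarrow> b v - v \<in> base_flag j"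
    and F: "F \<in> opposite_flags" and fixed: "image_flag b F = F"
  shows "b = id"
proof -
  interpret vector_space_pair scale scale ..
  obtain vs where vs: "ordered_basis scale vs" "flag vs = F" "length vs = n"
    "\<And>i. i < n \<Longrightarrow> level (vs ! i) = n - i"
    using opposite_basis[OF F] by metis
  have Fl: "F \<in> flags" "\<And>i. i < n \<Longrightarrow> jump F i = n - i"
    using F by (auto simp: opposite_flags_def)
  have "b (vs ! i) = vs ! i" if i: "i < n" for i
  proof (rule ccontr)
    let ?x = "b (vs ! i) - vs ! i"
    assume "b (vs ! i) \<noteq> vs ! i"
    then have x0: "?x \<notin> F 0" using flags_0[OF Fl(1)] by auto
    have "vs ! i \<in> F (Suc i)" using nth_in_flag_Suc[of i vs] i vs by simp
    moreover from this have "b (vs ! i) \<in> F (Suc i)"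
      using fixed unfolding image_flag_def by (metis imageI)
    ultimately have xF: "?x \<in> F (Suc i)" by (intro flags_diff[OF Fl(1)])
    define k where "k = (LEAST k. ?x \<in> F k)"
    have k: "?x \<in> F k" "k \<le> Suc i"
      unfolding k_def using xF by (auto intro: LeastI Least_le)
    then obtain j where j: "k = Suc j" using x0 by (cases k) auto
    have "?x \<notin> F j" using not_less_Least[of j "\<lambda>k. ?x \<in> F k"] j by (simp add: k_def)
    then have "n - j \<le> level ?x"
      using jump_le[of ?x F j] Fl(2)[of j] k j i by simp
    moreover have "level (vs ! i) = Suc (n - Suc i)" using vs(4)[OF i] i by simp
    then have "?x \<in> base_flag (n - Suc i)"
      using down[of "n - Suc i" "vs ! i"] i by (simp add: level_eq_Suc_iff)
    then have "level ?x \<le> n - Suc i" by (simp add: level_le_iff)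
    ultimately show False using k j i by simp
  qed
  then have "b x = id x" if "x \<in> set vs" for x
    using that vs(3) by (auto simp: in_set_conv_nth)
  then show ?thesis
    using linear_eq_on[of b id _ "set vs"] b basisD(3)[OF vs(1)] linear_id
    by (auto simp: GL_iff fun_eq_iff)
qed

definition St :: "('v \<Rightarrow> 'v) \<Rightarrow> complex" where "St = cell.\<chi>"

lemma St_Irr: "St \<in> Irr G"
  unfolding St_def by (rule cell.\<chi>_Irr)

text \<open>\<open>\<chi>_stab\<close> speaks only about the stabiliser of the base flag, so y is
  conjugated to u, which acts trivially on the steps of the base flag; such an element other than
  the identity fixes no opposite flag.\<close>

lemma St_unipotent:
  assumes y: "y \<in> unipotents" "y \<noteq> id"
  shows "St y = 0"
proof -
  have yG: "y \<in> carrier G" "Vector_Spaces.linear scale scale y"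
    using y by (auto simp: d_regular_elements_def GL_iff)
  obtain vs where vs: "ordered_basis scale vs" "\<And>i. i < n \<Longrightarrow> y (vs ! i) - vs ! i \<in> flag vs i"
    using unipotent_nilpotent[OF y(1)] unipotent_adapted_basis[OF yG(2)] by metis
  obtain h where h: "h \<in> carrier G" "map h bs = vs" using ex_GL_map[OF basis vs(1)] by blast
  let ?h' = "inv\<^bsub>G\<^esub> h"
  have h': "?h' \<in> carrier G" "?h' \<circ> h = id" using h cell.l_inv[OF h(1)] by auto
  then have h'h: "?h' (h x) = x" for x by (simp add: fun_eq_iff)
  interpret h': Vector_Spaces.linear scale scale ?h' using h' by (simp add: GL_iff)
  have flag: "?h' ` flag vs i = base_flag i" for i
  proof -
    have "map ?h' vs = bs" unfolding h(2)[symmetric] by (simp add: h'h map_idI)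
    then show ?thesis
      using image_flag_flag[OF h'(1), of vs] by (metis base_flag_def image_flag_def)
  qed
  define u where "u = ?h' \<circ> y \<circ> h"
  have u: "u \<in> carrier G"
    using cell.m_closed[OF cell.m_closed[OF h'(1) yG(1)] h(1)] by (simp add: u_def)
  interpret u: Vector_Spaces.linear scale scale u using u by (simp add: GL_iff)
  interpret vector_space_pair scale scale ..
  have lin: "Vector_Spaces.linear scale scale (\<lambda>v. u v - v)"
    using linear_compose_sub[OF u.linear_axioms linear_ident] .
  have step: "u (bs ! i) - bs ! i \<in> base_flag i" if i: "i < n" for i
  proof -
    have "h (bs ! i) = vs ! i" using h(2) i by (auto simp: n_def)
    then have "u (bs ! i) - bs ! i = ?h' (y (vs ! i) - vs ! i)"
      using h'h[of "bs ! i"] by (simp add: u_def h'.diff)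
    then show ?thesis using vs(2)[OF i] flag[of i] by auto
  qed
  \<comment> \<open>\<open>step\<close> concerns single basis vectors; linearity of u - id extends
    it to their span.\<close>
  have down: "u v - v \<in> base_flag j" if j: "j < n" and v: "v \<in> base_flag (Suc j)" for j v
  proof -
    let ?T = "set (take (Suc j) bs)"
    have "u x - x \<in> base_flag j" if x: "x \<in> ?T" for x
    proof -
      obtain i where i: "i \<le> j" "i < n" "x = bs ! i"
        using x j by (auto simp: in_set_conv_nth n_def less_Suc_eq_le)
      show ?thesis
        using step[OF i(2)] flags_mono[OF base_flag i(1)] i(3) by blast
    qed
    then have "span ((\<lambda>v. u v - v) ` ?T) \<subseteq> base_flag j"
      unfolding base_flag_def flag_def by (intro span_minimal subspace_span) blast
    moreover have "u v - v \<in> (\<lambda>v. u v - v) ` span ?T"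
      using v unfolding base_flag_def flag_def by (rule imageI)
    ultimately show ?thesis
      using linear_span_image[OF lin, of ?T] by blast
  qed
  have "u ` base_flag j = base_flag j" for j
  proof (cases "j < n")
    case True
    show ?thesis
    proof (rule endo_inj_surj)
      show "finite (base_flag j)" using finite_UNIV by (rule rev_finite_subset) simp
      show "inj_on u (base_flag j)" using u by (auto simp: GL_iff bij_def intro: inj_on_subset)
      show "u ` base_flag j \<subseteq> base_flag j"
      proof
        fix w assume "w \<in> u ` base_flag j"
        then obtain v where v: "w = u v" "v \<in> base_flag j" by blast
        then have "u v - v \<in> base_flag j" using down[OF True] flags_mono[OF base_flag, of j "Suc j"] by auto
        from flags_add[OF base_flag this v(2)] show "w \<in> base_flag j" using v(1) by simp
      qed
    qed
  qed (use u flags_top[OF base_flag] in \<open>auto simp: GL_iff bij_def\<close>)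
  then have stab: "u \<in> cell.stab" using u by (simp add: cell.stab_def image_flag_def)
  have y_conj: "y = h \<otimes>\<^bsub>G\<^esub> u \<otimes>\<^bsub>G\<^esub> ?h'"
  proof -
    have "h \<circ> ?h' = id" using cell.r_inv[OF h(1)] by simp
    then show ?thesis by (simp add: u_def fun_eq_iff) 
  qed
  have "u \<noteq> id"
  proof
    assume "u = id"
    then have "y = h \<circ> ?h'" using y_conj by simp
    then show False using y(2) cell.r_inv[OF h(1)] by simp
  qed
  then have "{x \<in> opposite_flags. image_flag u x = x} = {}"
    using fixed_opposite_flag[OF u down] by blast
  then have "St u = 0" using cell.\<chi>_stab[OF stab] by (simp only: St_def card.empty of_nat_0)
  then show ?thesis
    using cell.character_conj[OF St_Irr h(1) u] unfolding y_conj by simp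
qed

text \<open>The parabolic tests indices up to n only; beyond n the flag is the whole space, which
  every bijection preserves.\<close>

lemma borel_eq_stab: "standard_borel scale bs = cell.stab"
proof -
  have iff: "(\<forall>k\<le>n. g ` base_flag k = base_flag k) \<longleftrightarrow> image_flag g base_flag = base_flag"
    if "g \<in> carrier G" for g
  proof -
    have "g ` UNIV = UNIV" using that by (simp add: GL_iff bij_def)
    then have "g ` base_flag k = base_flag k" if "\<not> k \<le> n" for k
      using that flags_top[OF base_flag, of k] by simp
    then show ?thesis
      unfolding image_flag_def fun_eq_iff by blast
  qed
  have "sum_list (take k (replicate (length bs) 1)) = k" if "k \<le> length bs" for k
    using that by (simp add: sum_list_replicate)
  then have "standard_borel scale bs = {g \<in> carrier G. \<forall>k\<le>n. g ` base_flag k = base_flag k}"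
    by (simp add: standard_borel_def standard_parabolic_def base_flag_def flag_def n_def)
  then show ?thesis
    unfolding cell.stab_def using iff by blast
qed

lemma St_Unip: "St \<in> Unip scale bs"
  using St_Irr cell.\<chi>_multiplicity by (simp add: Unip_def St_def borel_eq_stab)

text \<open>Both orders appear because \<open>direct_link\<close> is a directed relation and the
  path in \<open>single_block\<close> enters and leaves \<open>St\<close>.\<close>

lemma inner_on_St:
  assumes \<chi>: "\<chi> \<in> Irr G" and n: "n > 0"
  shows "inner_on G unipotents \<chi> St \<noteq> 0" "inner_on G unipotents St \<chi> \<noteq> 0"
proof -
  have fin: "finite unipotents"
    using finite_GL by (rule rev_finite_subset) (auto simp: d_regular_elements_def)
  have sum: "(\<Sum>y\<in>unipotents. f y) = f id" if "\<And>y. y \<in> unipotents - {id} \<Longrightarrow> f y = 0" for f :: "_ \<Rightarrow> complex"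
    using sum.remove[OF fin id_unipotent[OF n], of f] that by simp
  have eq: "(\<Sum>y\<in>unipotents. \<chi> y * cnj (St y)) = \<chi> id * cnj (St id)"
    "(\<Sum>y\<in>unipotents. St y * cnj (\<chi> y)) = St id * cnj (\<chi> id)"
    using St_unipotent by (intro sum; metis DiffE singletonI complex_cnj_zero mult_zero_left mult_zero_right)+
  have ne: "\<chi> id \<noteq> 0" "St id \<noteq> 0"
    using cell.character_one_ne_zero[OF \<chi>] cell.character_one_ne_zero[OF St_Irr] by simp_all
  moreover have "Coset.order G > 0"
    using finite_GL cell.one_closed by (auto simp: Coset.order_def card_gt_0_iff)
  ultimately show "inner_on G unipotents \<chi> St \<noteq> 0" "inner_on G unipotents St \<chi> \<noteq> 0"
    unfolding inner_on_def eq by simp_all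
qed

lemma single_block:
  assumes "S \<subseteq> Irr G" "St \<in> S" "n > 0"
  shows "linking_blocks G unipotents S = {S}"
proof -
  let ?R = "direct_link G unipotents S"
  have "?R \<subseteq> S \<times> S" by (auto simp: direct_link_def)
  then have "?R\<^sup>+ \<subseteq> S \<times> S" by (rule trancl_subset_Sigma)
  moreover have "(a, b) \<in> ?R\<^sup>+" if "a \<in> S" "b \<in> S" for a b
  proof -
    have "(a, St) \<in> ?R" "(St, b) \<in> ?R"
      using that assms inner_on_St by (auto simp: direct_link_def)
    then show ?thesis by auto
  qed
  ultimately have "?R\<^sup>+ `` {a} = S" if "a \<in> S" for a using that by blast
  then show ?thesis
    using assms(2) by (auto simp: linking_blocks_def quotient_def)
qed

end

section \<open>Cores\<close>

lemma partition_removes_box: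
  assumes "is_partition \<alpha>" "\<alpha> \<noteq> []"
  shows "\<exists>\<beta>. removes_rim_hook 1 \<alpha> \<beta> \<and> sum_list \<beta> < sum_list \<alpha>"
proof -
  obtain xs x where \<alpha>: "\<alpha> = xs @ [x]" using assms(2) by (metis rev_exhaust)
  then have x: "x > 0" and xs: "0 \<notin> set xs" "sorted_wrt (\<ge>) xs" "\<forall>y\<in>set xs. x \<le> y"
    using assms(1) by (auto simp: is_partition_def sorted_wrt_append)
  \<comment> \<open>The last cell of the last row is removed; a row of one cell disappears
    altogether, as zero parts are excluded.\<close>
  define \<beta> where "\<beta> = (if x = 1 then xs else xs @ [x - 1])"
  have "is_partition \<beta>"
    using x xs by (auto simp: is_partition_def \<beta>_def sorted_wrt_append)
  moreover have sub: "young_diagram \<beta> \<subseteq> young_diagram \<alpha>"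
    by (auto simp: young_diagram_def \<alpha> \<beta>_def nth_append split: if_splits)
  moreover have R: "young_diagram \<alpha> - young_diagram \<beta> = {(length xs, x - 1)}"
    using x by (auto simp: young_diagram_def \<alpha> \<beta>_def nth_append less_Suc_eq split: if_splits)
  ultimately have "removes_rim_hook 1 \<alpha> \<beta>"
    using assms(1) unfolding removes_rim_hook_def R by (auto simp: Let_def connected_cells_def)
  moreover have "sum_list \<beta> < sum_list \<alpha>" using x by (auto simp: \<alpha> \<beta>_def)
  ultimately show ?thesis by blast
qed

text \<open>Every nonempty partition still has a removable cell, so removal can stop only at the
  empty one; this gives existence and uniqueness for the \<open>THE\<close>.\<close>

lemma d_core_1:
  assumes "is_partition \<alpha>"
  shows "d_core 1 \<alpha> = []"
proof -
  let ?R = "{(\<gamma>, \<delta>). removes_rim_hook 1 \<gamma> \<delta>}"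
  have reach: "(\<alpha>, []) \<in> ?R\<^sup>*"
    using assms
  proof (induction "sum_list \<alpha>" arbitrary: \<alpha> rule: less_induct)
    case less
    show ?case
    proof (cases "\<alpha> = []")
      case False
      then obtain \<beta> where \<beta>: "removes_rim_hook 1 \<alpha> \<beta>" "sum_list \<beta> < sum_list \<alpha>"
        using partition_removes_box less.prems by blast
      moreover from this have "is_partition \<beta>" by (simp add: removes_rim_hook_def)
      ultimately show ?thesis
        using less.hyps[of \<beta>] by (auto intro: converse_rtrancl_into_rtrancl)
    qed simp
  qed
  have empty: "\<not> removes_rim_hook 1 [] \<kappa>" for \<kappa>
    by (auto simp: removes_rim_hook_def young_diagram_def Let_def)
  have part: "is_partition \<beta>" if "(\<alpha>, \<beta>) \<in> ?R\<^sup>*" for \<beta>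
    using that assms by (induction rule: rtrancl_induct) (auto simp: removes_rim_hook_def)
  show ?thesis
    unfolding d_core_def
    by (rule the_equality) (use reach empty part partition_removes_box in blast)+
qed

theorem theorem4p5:
  fixes scale :: "'k::{field,finite} \<Rightarrow> 'v::ab_group_add \<Rightarrow> 'v"
    and q n :: nat
    and bs :: "'v list"
  assumes "primepow q" and "CARD('k) = q"
    and "vector_space scale" and "vector_space.dim scale (UNIV :: 'v set) = n" and "n > 0"
    and "ordered_basis scale bs"
  shows "linking_blocks (GL scale) (d_regular_elements scale 1) (Irr (GL scale)) = {Irr (GL scale)} \<and>
    linking_blocks (GL scale) (d_regular_elements scale 1) (Unip scale bs) = {Unip scale bs} \<and>
    (\<forall>\<chi>. unipotent_labelling scale bs \<chi> \<longrightarrow>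
      (\<forall>\<alpha> \<in> partitions n. \<forall>\<beta> \<in> partitions n.
        (\<exists>B \<in> linking_blocks (GL scale) (d_regular_elements scale 1) (Unip scale bs).
            \<chi> \<alpha> \<in> B \<and> \<chi> \<beta> \<in> B) \<longleftrightarrow>
        d_core 1 \<alpha> = d_core 1 \<beta>))"
proof -
  interpret vector_space scale by fact
  interpret flag_space scale bs by unfold_locales fact
  \<comment> \<open>The \<open>n\<close> of the statement is a dimension, that of the locale the
    length of \<open>bs\<close>.\<close>
  have len: "length bs = n" using length_basis[OF assms(6)] assms(4) by simp
  then have pos: "flag_space.n bs > 0" using assms(5) by (simp add: n_def)
  have "Unip scale bs \<subseteq> Irr (GL scale)" by (auto simp: Unip_def)
  then have unip: "linking_blocks (GL scale) (d_regular_elements scale 1) (Unip scale bs) = {Unip scale bs}"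
    using single_block[OF _ St_Unip pos] by blast
  moreover have "linking_blocks (GL scale) (d_regular_elements scale 1) (Irr (GL scale)) = {Irr (GL scale)}"
    using single_block[OF _ St_Irr pos] by blast
  moreover have "\<chi> \<alpha> \<in> Unip scale bs"
    if "unipotent_labelling scale bs \<chi>" "\<alpha> \<in> partitions n" for \<chi> \<alpha>
    using that len by (simp add: unipotent_labelling_def Let_def)
  moreover have "d_core 1 \<alpha> = []" if "\<alpha> \<in> partitions n" for \<alpha>
    using that d_core_1 by (simp add: partitions_def)
  \<comment> \<open>Both sides of the equivalence are true for all labels: there is one block, and
    all cores are empty.\<close>
  ultimately show ?thesis by simp
qed

end
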